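(* Let $\mathcal{Q} = \{q_y\}_{y \in Y_{\mathcal{Q}}}$, $Y_{\mathcal{Q}} \subseteq \{0,1\}^m$, be a set of counting queries over the data universe $\mathcal{X} = \{0,1\}^d$, and let $\mathcal{F}_{\mathcal{Q}}$ be its $\mathcal{Q}$-function family. Assume that $\mathcal{P}_{t,T}$ efficiently and uniformly $\gamma$-approximates $\mathcal{F}_{\mathcal{Q}}$ on $Y_{\mathcal{Q}}$. Let $N = \binom{m+t}{t}$. Then for every $\varepsilon>0$ and $\delta>0$ there is a sanitizer $\mathcal{A}: (\{0,1\}^d)^n \to \mathbb{R}^{N}$ (with an evaluator) that (1) is $(\varepsilon,\delta)$-differentially private, (2) runs in time $\mathrm{poly}(n, d, N, \log T, \log(1/\varepsilon), \log(1/\delta))$, and (3) is $(\alpha,\beta)$-accurate for $\mathcal{Q}$ for every $\beta>0$, where $\alpha = \gamma + \frac{12 T N\sqrt{N\log(1/\delta)}\,\log(N/\beta)}{\varepsilon n}$.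
   Context: A database $D \in \mathcal{X}^n$ is a list of rows $x^{(1)},\dots,x^{(n)}$; adjacent databases differ in exactly one row. A counting query is a predicate $q:\mathcal{X}\to\{0,1\}$ with $q(D)=\frac1n\sum_i q(x^{(i)})$. A sanitizer $\mathcal{A}$ is a randomized map from databases to a set $\mathcal{R}$, with answers computed by an evaluator $\mathcal{E}:\mathcal{R}\times\mathcal{Q}\to\mathbb{R}$ (whose running time is included); write $q(\mathcal{A}(D))=\mathcal{E}(\mathcal{A}(D),q)$. $\mathcal{A}$ is $(\varepsilon,\delta)$-differentially private if for all adjacent $D,D'$ and measurable $S$, $\Pr[\mathcal{A}(D)\in S]\le e^\varepsilon \Pr[\mathcal{A}(D')\in S]+\delta$. $\mathcal{A}$ is $(\alpha,\beta)$-accurate for $\mathcal{Q}$ if for every $D$, $\Pr[\forall q\in\mathcal{Q}: |q(\mathcal{A}(D))-q(D)|\le\alpha]\ge 1-\beta$. The $\mathcal{Q}$-function family is $\mathcal{F}_{\mathcal{Q}}=\{f_x\}_{x\in\mathcal{X}}$ with $f_x(y)=q_y(x)$ for $y \in \{0,1\}^m$. $\mathcal{P}_{t,T}$ is the set of $m$-variate real polynomials of total degree at most $t$ with all coefficients of absolute value at most $T$, identified with coefficient vectors in $[-T,T]^{\binom{m+t}{t}}$. $\mathcal{P}_{t,T}$ uniformly $\gamma$-approximates $\{f_x\}_{x\in\mathcal{X}}$ on $Y$ if for every $x$ there is $p_x\in\mathcal{P}_{t,T}$ with $\max_{y\in Y}|f_x(y)-p_x(y)|\le\gamma$; efficiently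 if an algorithm on input $x$ outputs the coefficient vector of such $p_x$ in time $\mathrm{poly}(\log|\mathcal{X}|,\binom{m+t}{t},\log T)$.
   Formalization: The claim is proved for ε ≤ 50·ln(1/δ) (so δ < 1) and n ≥ 1, not for every ε, δ > 0: for δ > 1 the bound α is undefined, and for δ close to 1 the claim fails (e.g. ε = n = N = T = 1). Running time is counted on a real-number machine with exact unit-cost arithmetic. *)

theory Defs
  imports "HOL-Probability.Probability"
begin

section \<open>Randomized real-number programs with a running time\<close>

text \<open>
  Coefficient vectors, sanitizer outputs and noise are genuine real vectors, so the machine model is
  a real RAM: exact real arithmetic (including square root and logarithm) at unit cost. It is
  presented as a structured WHILE language over binary trees with real leaves, in the style of
  Jones's WHILE language. Literals are integers, so that no information can be hidden in a real
  constant of a program; there is no rounding operation.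
  Randomness is an infinite tape of independent uniform samples from \<open>[0,1]\<close>, read sequentially.
\<close>

datatype val = VNil | VReal real | VPair val val

datatype expr =
    Var nat
  | Empty
  | Lit int
  | Join expr expr
  | First expr
  | Second expr
  | IsPair expr
  | Plus expr expr
  | Minus expr expr
  | Times expr expr
  | Divide expr expr
  | Sqrt expr
  | Ln expr
  | Leq expr expr

datatype prog =
    Assign nat expr
  | Sample nat
  | Seq prog prog
  | Cond expr prog prog
  | While expr prog

fun num :: "val \<Rightarrow> real" where
  "num (VReal a) = a"
| "num _ = 0"

fun left :: "val \<Rightarrow> val" where
  "left (VPair u v) = u"
| "left _ = VNil"

fun right :: "val \<Rightarrow> val" where
  "right (VPair u v) = v"
| "right _ = VNil"

fun is_pair :: "val \<Rightarrow> bool" where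
  "is_pair (VPair u v) = True"
| "is_pair _ = False"

definition enc_bool :: "bool \<Rightarrow> val" where
  "enc_bool b = VReal (of_bool b)"

primrec eval :: "expr \<Rightarrow> (nat \<Rightarrow> val) \<Rightarrow> val" where
  "eval (Var i) s = s i"
| "eval Empty s = VNil"
| "eval (Lit z) s = VReal (of_int z)"
| "eval (Join a b) s = VPair (eval a s) (eval b s)"
| "eval (First a) s = left (eval a s)"
| "eval (Second a) s = right (eval a s)"
| "eval (IsPair a) s = enc_bool (is_pair (eval a s))"
| "eval (Plus a b) s = VReal (num (eval a s) + num (eval b s))"
| "eval (Minus a b) s = VReal (num (eval a s) - num (eval b s))"
| "eval (Times a b) s = VReal (num (eval a s) * num (eval b s))"
| "eval (Divide a b) s = VReal (num (eval a s) / num (eval b s))"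
| "eval (Sqrt a) s = VReal (sqrt (num (eval a s)))"
| "eval (Ln a) s = VReal (ln (num (eval a s)))"
| "eval (Leq a b) s = enc_bool (num (eval a s) \<le> num (eval b s))"

primrec cost :: "expr \<Rightarrow> nat" where
  "cost (Var i) = 1"
| "cost Empty = 1"
| "cost (Lit z) = 1"
| "cost (Join a b) = 1 + cost a + cost b"
| "cost (First a) = 1 + cost a"
| "cost (Second a) = 1 + cost a"
| "cost (IsPair a) = 1 + cost a"
| "cost (Plus a b) = 1 + cost a + cost b"
| "cost (Minus a b) = 1 + cost a + cost b"
| "cost (Times a b) = 1 + cost a + cost b"
| "cost (Divide a b) = 1 + cost a + cost b"
| "cost (Sqrt a) = 1 + cost a"
| "cost (Ln a) = 1 + cost a"
| "cost (Leq a b) = 1 + cost a + cost b"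

text \<open>
  A configuration is a store together with the position of the tape head. \<open>exec \<omega> P c \<tau> c'\<close> means
  that on tape \<open>\<omega>\<close> the program \<open>P\<close> started in \<open>c\<close> stops in \<open>c'\<close> after time exactly \<open>\<tau>\<close>. A guard
  counts as true unless it evaluates to the number 0.
\<close>

inductive exec ::
  "(nat \<Rightarrow> real) \<Rightarrow> prog \<Rightarrow> (nat \<Rightarrow> val) \<times> nat \<Rightarrow> nat \<Rightarrow> (nat \<Rightarrow> val) \<times> nat \<Rightarrow> bool"
  for \<omega> :: "nat \<Rightarrow> real" where
  Assign: "exec \<omega> (Assign i e) (s, p) (1 + cost e) (s(i := eval e s), p)"
| Sample: "exec \<omega> (Sample i) (s, p) 1 (s(i := VReal (\<omega> p)), Suc p)"
| Seq: "exec \<omega> P c \<tau> c' \<Longrightarrow> exec \<omega> P' c' \<tau>' c'' \<Longrightarrow> exec \<omega> (Seq P P') c (\<tau> + \<tau>') c''"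
| CondTrue: "eval e s \<noteq> VReal 0 \<Longrightarrow> exec \<omega> P (s, p) \<tau> c'
    \<Longrightarrow> exec \<omega> (Cond e P P') (s, p) (1 + cost e + \<tau>) c'"
| CondFalse: "eval e s = VReal 0 \<Longrightarrow> exec \<omega> P' (s, p) \<tau> c'
    \<Longrightarrow> exec \<omega> (Cond e P P') (s, p) (1 + cost e + \<tau>) c'"
| WhileFalse: "eval e s = VReal 0 \<Longrightarrow> exec \<omega> (While e P) (s, p) (1 + cost e) (s, p)"
| WhileTrue: "eval e s \<noteq> VReal 0 \<Longrightarrow> exec \<omega> P (s, p) \<tau> c'
    \<Longrightarrow> exec \<omega> (While e P) c' \<tau>' c'' \<Longrightarrow> exec \<omega> (While e P) (s, p) (1 + cost e + \<tau> + \<tau>') c''"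

text \<open>Input and output are passed in variable 0; all other variables are initially \<open>VNil\<close>.\<close>

definition runs_within :: "(nat \<Rightarrow> real) \<Rightarrow> prog \<Rightarrow> val \<Rightarrow> val \<Rightarrow> real \<Rightarrow> bool" where
  "runs_within \<omega> P inp out b \<longleftrightarrow>
     (\<exists>\<tau> s p. exec \<omega> P ((\<lambda>_. VNil)(0 := inp), 0) \<tau> (s, p) \<and> s 0 = out \<and> real \<tau> \<le> b)"

primrec deterministic :: "prog \<Rightarrow> bool" where
  "deterministic (Assign i e) \<longleftrightarrow> True"
| "deterministic (Sample i) \<longleftrightarrow> False"
| "deterministic (Seq P P') \<longleftrightarrow> deterministic P \<and> deterministic P'"
| "deterministic (Cond e P P') \<longleftrightarrow> deterministic P \<and> deterministic P'"
| "deterministic (While e P) \<longleftrightarrow> deterministic P"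

definition tape :: "(nat \<Rightarrow> real) measure" where
  "tape = PiM UNIV (\<lambda>_. uniform_measure lborel {0..1})"

text \<open>A quantity is \<open>poly(a\<^sub>1, \<dots>, a\<^sub>r)\<close> if it is at most \<open>poly_bound c k [a\<^sub>1, \<dots>, a\<^sub>r]\<close> for constants
  \<open>c, k\<close>; it is only applied to nonnegative arguments.\<close>

definition poly_bound :: "nat \<Rightarrow> nat \<Rightarrow> real list \<Rightarrow> real" where
  "poly_bound c k as = real c * (1 + sum_list as) ^ k"

primrec enc_list :: "val list \<Rightarrow> val" where
  "enc_list [] = VNil"
| "enc_list (v # vs) = VPair v (enc_list vs)"

definition enc_bits :: "bool list \<Rightarrow> val" where
  "enc_bits bs = enc_list (map enc_bool bs)"

definition enc_reals :: "real list \<Rightarrow> val" where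
  "enc_reals as = enc_list (map VReal as)"


section \<open>Databases, counting queries and sanitizers\<close>

definition cube :: "nat \<Rightarrow> bool list set" where
  "cube d = {x. length x = d}"

definition databases :: "nat \<Rightarrow> 'x set \<Rightarrow> 'x list set" where
  "databases n X = {D. length D = n \<and> set D \<subseteq> X}"

definition adjacent :: "'x list \<Rightarrow> 'x list \<Rightarrow> bool" where
  "adjacent D D' \<longleftrightarrow> length D = length D' \<and> card {i. i < length D \<and> D ! i \<noteq> D' ! i} = 1"

definition counting_query :: "('x \<Rightarrow> bool) \<Rightarrow> 'x list \<Rightarrow> real" where
  "counting_query q D = (\<Sum>x\<leftarrow>D. of_bool (q x)) / real (length D)"

text \<open>Real vectors of length \<open>N\<close> are functions on \<open>{..<N}\<close>, \<open>undefined\<close> elsewhere.\<close>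

definition vec_space :: "nat \<Rightarrow> (nat \<Rightarrow> real) measure" where
  "vec_space N = PiM {..<N} (\<lambda>_. borel)"

definition enc_vec :: "nat \<Rightarrow> (nat \<Rightarrow> real) \<Rightarrow> val" where
  "enc_vec N r = enc_reals (map r [0..<N])"

text \<open>A sanitizer \<open>M\<close> maps a database to the distribution of its output.\<close>

definition differentially_private ::
  "real \<Rightarrow> real \<Rightarrow> 'x list set \<Rightarrow> ('x list \<Rightarrow> 'r measure) \<Rightarrow> bool" where
  "differentially_private \<epsilon> \<delta> DB M \<longleftrightarrow>
     (\<forall>D\<in>DB. \<forall>D'\<in>DB. adjacent D D' \<longrightarrow>
        (\<forall>S\<in>sets (M D). measure (M D) S \<le> exp \<epsilon> * measure (M D') S + \<delta>))"

definition accurate ::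
  "real \<Rightarrow> real \<Rightarrow> 'x list set \<Rightarrow> 'y set \<Rightarrow> ('y \<Rightarrow> 'x \<Rightarrow> bool)
    \<Rightarrow> ('x list \<Rightarrow> 'r measure) \<Rightarrow> ('r \<Rightarrow> 'y \<Rightarrow> real) \<Rightarrow> bool" where
  "accurate \<alpha> \<beta> DB Y q M ans \<longleftrightarrow>
     (\<forall>D\<in>DB. measure (M D)
        {r \<in> space (M D). \<forall>y\<in>Y. \<bar>ans r y - counting_query (q y) D\<bar> \<le> \<alpha>} \<ge> 1 - \<beta>)"

text \<open>The program \<open>P\<close> on input \<open>inp\<close> samples from the distribution \<open>\<mu>\<close> on length-\<open>N\<close> real vectors,
  with worst-case running time at most \<open>b\<close>.\<close>

definition samples_within :: "prog \<Rightarrow> val \<Rightarrow> nat \<Rightarrow> (nat \<Rightarrow> real) measure \<Rightarrow> real \<Rightarrow> bool" where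
  "samples_within P inp N \<mu> b \<longleftrightarrow>
     (\<exists>f \<in> measurable tape (vec_space N).
        (\<forall>\<omega> \<in> space tape. runs_within \<omega> P inp (enc_vec N (f \<omega>)) b) \<and>
        \<mu> = distr tape (vec_space N) f)"


section \<open>Polynomials of bounded degree and coefficients\<close>

text \<open>The exponent vectors of the \<open>m\<close>-variate monomials of total degree at most \<open>t\<close>; their order
  fixes the identification of polynomials with coefficient vectors.\<close>

fun exponents :: "nat \<Rightarrow> nat \<Rightarrow> nat list list" where
  "exponents 0 t = [[]]"
| "exponents (Suc m) t = concat (map (\<lambda>k. map ((#) k) (exponents m (t - k))) [0..<Suc t])"

lemma set_exponents: "set (exponents m t) = {e. length e = m \<and> sum_list e \<le> t}"
proof (induction m arbitrary: t)
  case (Suc m)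
  show ?case
  proof (intro equalityI subsetI)
    fix e assume "e \<in> set (exponents (Suc m) t)"
    then show "e \<in> {e. length e = Suc m \<and> sum_list e \<le> t}"
      using Suc by (auto simp del: upt_Suc)
  next
    fix e assume e: "e \<in> {e. length e = Suc m \<and> sum_list e \<le> t}"
    then obtain k e' where "e = k # e'" by (cases e) auto
    then show "e \<in> set (exponents (Suc m) t)"
      using e Suc by (auto simp del: upt_Suc intro!: bexI[of _ k])
  qed
qed auto

lemma length_exponents: "length (exponents m t) = (m + t) choose t"
proof (induction m arbitrary: t)
  case (Suc m)
  have "length (exponents (Suc m) t) = (\<Sum>k = 0..<Suc t. (m + (t - k)) choose (t - k))"
    by (simp add: length_concat comp_def Suc sum_list_distinct_conv_sum_set del: upt_Suc)
  also have "\<dots> = (\<Sum>j\<le>t. (m + j) choose j)"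
    by (rule sum.reindex_bij_witness[of _ "\<lambda>j. t - j" "\<lambda>k. t - k"]) auto
  also have "\<dots> = (Suc m + t) choose t"
    using sum_choose_lower[of m t] by simp
  finally show ?case .
qed auto

lemma distinct_exponents: "distinct (exponents m t)"
proof (induction m arbitrary: t)
  case (Suc m)
  have "distinct (concat (map (\<lambda>k. map ((#) k) (exponents m (t - k))) ks))"
    if "distinct ks" for ks :: "nat list"
    using that by (induction ks) (auto simp: distinct_map Suc)
  then show ?case by (simp del: upt_Suc)
qed auto

definition poly_val :: "nat \<Rightarrow> nat \<Rightarrow> real list \<Rightarrow> (nat \<Rightarrow> real) \<Rightarrow> real" where
  "poly_val m t a z =
     (\<Sum>j < (m + t) choose t. a ! j * (\<Prod>i<m. z i ^ (exponents m t ! j ! i)))"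

definition bounded_polys :: "nat \<Rightarrow> nat \<Rightarrow> real \<Rightarrow> real list set" where
  "bounded_polys m t T = {a. length a = (m + t) choose t \<and> (\<forall>b\<in>set a. \<bar>b\<bar> \<le> T)}"

definition family_fun :: "('y \<Rightarrow> 'x \<Rightarrow> bool) \<Rightarrow> 'x \<Rightarrow> 'y \<Rightarrow> real" where
  "family_fun q x y = of_bool (q y x)"

definition approximants ::
  "nat \<Rightarrow> nat \<Rightarrow> real \<Rightarrow> real \<Rightarrow> bool list set \<Rightarrow> (bool list \<Rightarrow> real) \<Rightarrow> real list set" where
  "approximants m t T \<gamma> Y f =
     {a \<in> bounded_polys m t T. \<forall>y\<in>Y. \<bar>f y - poly_val m t a (\<lambda>i. of_bool (y ! i))\<bar> \<le> \<gamma>}"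

text \<open>
  Polynomial time refers to a family of instances handled by one program. A bit string \<open>desc\<close>
  indexes the family, and it is passed to the programs together with the numerical parameters.
  Running times are not allowed to grow with the length of \<open>desc\<close>.
\<close>

definition enc_instance :: "bool list \<Rightarrow> nat \<Rightarrow> nat \<Rightarrow> nat \<Rightarrow> real \<Rightarrow> val" where
  "enc_instance desc d m t T =
     enc_list [enc_bits desc, VReal (real d), VReal (real m), VReal (real t), VReal T]"

text \<open>The program \<open>B\<close>, in time at most \<open>poly_bound c k [d, N, |log T|]\<close>, outputs on input \<open>x\<close> the
  coefficients of a polynomial that is \<open>\<gamma>\<close>-close to \<open>f\<^sub>x\<close> on \<open>Y\<close>.\<close>

definition efficiently_uniformly_approximates ::
  "prog \<Rightarrow> nat \<Rightarrow> nat \<Rightarrow> bool list \<Rightarrow> nat \<Rightarrow> nat \<Rightarrow> nat \<Rightarrow> real \<Rightarrow> real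
    \<Rightarrow> bool list set \<Rightarrow> (bool list \<Rightarrow> bool list \<Rightarrow> bool) \<Rightarrow> bool" where
  "efficiently_uniformly_approximates B c k desc d m t T \<gamma> Y q \<longleftrightarrow>
     (\<forall>x \<in> cube d. \<exists>a \<in> approximants m t T \<gamma> Y (family_fun q x). \<forall>\<omega>.
        runs_within \<omega> B (VPair (enc_instance desc d m t T) (enc_bits x)) (enc_reals a)
          (poly_bound c k [real d, real ((m + t) choose t), \<bar>ln T\<bar>]))"

definition sanitizer_input ::
  "val \<Rightarrow> nat \<Rightarrow> real \<Rightarrow> real \<Rightarrow> bool list list \<Rightarrow> val" where
  "sanitizer_input inst n \<epsilon> \<delta> D =
     enc_list [inst, VReal (real n), VReal \<epsilon>, VReal \<delta>, enc_list (map enc_bits D)]"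

definition evaluator_input ::
  "val \<Rightarrow> nat \<Rightarrow> real \<Rightarrow> real \<Rightarrow> nat \<Rightarrow> (nat \<Rightarrow> real) \<Rightarrow> bool list \<Rightarrow> val" where
  "evaluator_input inst n \<epsilon> \<delta> N r y =
     enc_list [inst, VReal (real n), VReal \<epsilon>, VReal \<delta>, enc_vec N r, enc_bits y]"

end

theory Submission
  imports Defs
begin

text \<open>
  The sanitizer averages the coefficient vectors of the approximating polynomials of the rows and adds
  independent Laplace noise of scale \<open>b = 12 T sqrt (N ln (1/\<delta>)) / (\<epsilon> n)\<close> to each of the \<open>N\<close>
  coefficients; the evaluator evaluates the noisy polynomial.

  Privacy: changing one row moves each coefficient by at most \<open>2 T / n\<close>, so the densities of a noisy
  coefficient differ by a factor \<open>w\<close> with \<open>\<bar>ln w\<bar> \<le> \<eta> = \<epsilon> / (6 sqrt (N ln (1/\<delta>)))\<close>. The moments of \<open>w\<close>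
  satisfy \<open>E (w powr (1 + \<kappa>)) \<le> exp (\<kappa> (\<kappa> + 1) \<eta>\<^sup>2 / 2)\<close>, and Markov's inequality for the product of
  the \<open>N\<close> factors at \<open>\<kappa> = 11 ln (1/\<delta>) / \<epsilon>\<close> gives \<open>(\<epsilon>, \<delta>)\<close>-privacy.

  Accuracy: with probability at least \<open>1 - \<beta>\<close> all noise terms are at most \<open>b ln (N/\<beta>)\<close> in absolute
  value, and at Boolean points every monomial is \<open>0\<close> or \<open>1\<close>.
\<close>

section \<open>Programs\<close>

text \<open>Worst-case losses of the \<open>N\<close> coefficients add up to \<open>N * \<eta> =
  \<epsilon> * sqrt N / (6 * sqrt (ln (1/\<delta>)))\<close>, too much by a factor of order
  \<open>sqrt N\<close>. What saves the budget is that a likelihood ratio has mean 1, so its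
  logarithm drifts only by order \<open>\<eta>\<^sup>2\<close>. The moment of order
  \<open>1 + \<kappa>\<close>, an exponentiated Renyi divergence, captures this and is
  multiplicative over independent coefficients. With \<open>l = ln (1/\<delta>)\<close> and
  \<open>\<kappa> = s * l / \<epsilon>\<close> the exponent of the failure term is
  \<open>s * (s * l + \<epsilon>) / 72 - s * l\<close>, where
  \<open>72 = 2 * (12 / 2)\<^sup>2\<close> stems from the noise scale;
  \<open>\<epsilon> \<le> 50 * l\<close> controls the part linear in \<open>\<epsilon>\<close>, and
  \<open>s = 11\<close> is the midpoint of the admissible interval from 4 to 18. On the machine
  side, \<open>B\<close> is known only by its runs from a blank store with the tape head at 0, yet
  it is called once per row, and times may not grow with \<open>desc\<close>, \<open>m\<close> or
  \<open>t\<close>. Hence states are single values copied at unit cost, and \<open>N\<close> is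
  found by counting coefficients.\<close>

primrec expr_bound :: "expr \<Rightarrow> nat" where
  "expr_bound (Var i) = Suc i"
| "expr_bound Empty = 0"
| "expr_bound (Lit z) = 0"
| "expr_bound (Join a b) = max (expr_bound a) (expr_bound b)"
| "expr_bound (First a) = expr_bound a"
| "expr_bound (Second a) = expr_bound a"
| "expr_bound (IsPair a) = expr_bound a"
| "expr_bound (Plus a b) = max (expr_bound a) (expr_bound b)"
| "expr_bound (Minus a b) = max (expr_bound a) (expr_bound b)"
| "expr_bound (Times a b) = max (expr_bound a) (expr_bound b)"
| "expr_bound (Divide a b) = max (expr_bound a) (expr_bound b)"
| "expr_bound (Sqrt a) = expr_bound a"
| "expr_bound (Ln a) = expr_bound a"
| "expr_bound (Leq a b) = max (expr_bound a) (expr_bound b)"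

primrec prog_bound :: "prog \<Rightarrow> nat" where
  "prog_bound (Assign i e) = max (Suc i) (expr_bound e)"
| "prog_bound (Sample i) = Suc i"
| "prog_bound (Seq P P') = max (prog_bound P) (prog_bound P')"
| "prog_bound (Cond e P P') = max (expr_bound e) (max (prog_bound P) (prog_bound P'))"
| "prog_bound (While e P) = max (expr_bound e) (prog_bound P)"

lemma eval_cong: "(\<And>i. i < expr_bound e \<Longrightarrow> s i = s' i) \<Longrightarrow> eval e s = eval e s'"
  by (induction e) auto

text \<open>A deterministic program neither reads the tape nor moves its head, and it sees only
  variables below \<open>prog_bound\<close>. A run therefore replays with the same time from any
  store that agrees below \<open>K\<close> and at any head position; this makes a hypothesis about
  isolated runs of \<open>B\<close> usable inside a larger program.\<close>

lemma exec_frame: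
  assumes "exec \<omega> P c \<tau> c'" "deterministic P" "prog_bound P \<le> K" "\<And>i. i < K \<Longrightarrow> r i = fst c i"
  shows "\<exists>r'. exec \<omega> P (r, p) \<tau> (r', p) \<and> (\<forall>i<K. r' i = fst c' i) \<and> (\<forall>i\<ge>K. r' i = r i)"
  using assms
proof (induction arbitrary: r rule: exec.induct)
  case (Assign i e s q)
  have "eval e r = eval e s" using Assign by (intro eval_cong) auto
  then have "exec \<omega> (Assign i e) (r, p) (1 + cost e) (r(i := eval e s), p)"
    using exec.Assign[of \<omega> i e r p] by simp
  moreover have "\<forall>j<K. (r(i := eval e s)) j = (s(i := eval e s)) j"
      "\<forall>j\<ge>K. (r(i := eval e s)) j = r j"
    using Assign.prems by auto
  ultimately show ?case by (metis fst_conv)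
next
  case (Seq P c \<tau> c' P' \<tau>' c'')
  obtain r1 where r1: "exec \<omega> P (r, p) \<tau> (r1, p)" "\<forall>i<K. r1 i = fst c' i" "\<forall>i\<ge>K. r1 i = r i"
    using Seq.IH(1)[of r] Seq.prems by auto
  obtain r2 where r2: "exec \<omega> P' (r1, p) \<tau>' (r2, p)" "\<forall>i<K. r2 i = fst c'' i" "\<forall>i\<ge>K. r2 i = r1 i"
    using Seq.IH(2)[of r1] Seq.prems r1 by auto
  show ?case using exec.Seq[OF r1(1) r2(1)] r1 r2 by auto
next
  case (CondTrue e s P q \<tau> c' P')
  have e: "eval e r = eval e s" using CondTrue.prems by (intro eval_cong) auto
  obtain r1 where r1: "exec \<omega> P (r, p) \<tau> (r1, p)" "\<forall>i<K. r1 i = fst c' i" "\<forall>i\<ge>K. r1 i = r i"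
    using CondTrue.IH[of r] CondTrue.prems by auto
  show ?case using exec.CondTrue[of e r \<omega> P p \<tau> "(r1, p)" P'] r1 e CondTrue.hyps by auto
next
  case (CondFalse e s P' q \<tau> c' P)
  have e: "eval e r = eval e s" using CondFalse.prems by (intro eval_cong) auto
  obtain r1 where r1: "exec \<omega> P' (r, p) \<tau> (r1, p)" "\<forall>i<K. r1 i = fst c' i" "\<forall>i\<ge>K. r1 i = r i"
    using CondFalse.IH[of r] CondFalse.prems by auto
  show ?case using exec.CondFalse[of e r \<omega> P' p \<tau> "(r1, p)" P] r1 e CondFalse.hyps by auto
next
  case (WhileFalse e s P q)
  have e: "eval e r = eval e s" using WhileFalse.prems by (intro eval_cong) auto
  show ?case using exec.WhileFalse[of e r \<omega> P p] e WhileFalse by auto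
next
  case (WhileTrue e s P q \<tau> c' \<tau>' c'')
  have e: "eval e r = eval e s" using WhileTrue.prems by (intro eval_cong) auto
  obtain r1 where r1: "exec \<omega> P (r, p) \<tau> (r1, p)" "\<forall>i<K. r1 i = fst c' i" "\<forall>i\<ge>K. r1 i = r i"
    using WhileTrue.IH(1)[of r] WhileTrue.prems by auto
  obtain r2 where r2: "exec \<omega> (While e P) (r1, p) \<tau>' (r2, p)" "\<forall>i<K. r2 i = fst c'' i"
      "\<forall>i\<ge>K. r2 i = r1 i"
    using WhileTrue.IH(2)[of r1] WhileTrue.prems r1 by auto
  show ?case using exec.WhileTrue[OF _ r1(1) r2(1)] r1 r2 e WhileTrue.hyps by auto
qed auto

text \<open>Only the variable \<open>K\<close> and the tape position are tracked, all other variables are scratch space;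
  \<open>b\<close> is an upper bound on the time.\<close>

definition steps ::
  "(nat \<Rightarrow> real) \<Rightarrow> nat \<Rightarrow> prog \<Rightarrow> val \<times> nat \<Rightarrow> real \<Rightarrow> val \<times> nat \<Rightarrow> bool" where
  "steps \<omega> K P a b a' \<longleftrightarrow> (\<forall>s. s K = fst a \<longrightarrow>
     (\<exists>s' \<tau>. exec \<omega> P (s, snd a) \<tau> (s', snd a') \<and> s' K = fst a' \<and> real \<tau> \<le> b))"

section \<open>Time-bounded triples for the program constructs\<close>

lemma steps_mono: "steps \<omega> K P a b a' \<Longrightarrow> b \<le> b' \<Longrightarrow> steps \<omega> K P a b' a'"
  unfolding steps_def by (meson order_trans)

lemma steps_assign:
  assumes "\<And>s. s K = v \<Longrightarrow> eval e s = v'" "1 + real (cost e) \<le> b"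
  shows "steps \<omega> K (Assign K e) (v, p) b (v', p)"
  unfolding steps_def
proof (intro allI impI)
  fix s :: "nat \<Rightarrow> val" assume "s K = fst (v, p)"
  then show "\<exists>s' \<tau>. exec \<omega> (Assign K e) (s, snd (v, p)) \<tau> (s', snd (v', p)) \<and>
      s' K = fst (v', p) \<and> real \<tau> \<le> b"
    using exec.Assign[of \<omega> K e s p] assms by (intro exI[of _ "s(K := eval e s)"]) auto
qed

lemma steps_sample:
  assumes "\<And>s. s K = v \<Longrightarrow> s i = VReal (\<omega> p) \<Longrightarrow> eval e s = v'" "i \<noteq> K" "2 + real (cost e) \<le> b"
  shows "steps \<omega> K (Seq (Sample i) (Assign K e)) (v, p) b (v', Suc p)"
  unfolding steps_def
proof (intro allI impI)
  fix s :: "nat \<Rightarrow> val" assume s: "s K = fst (v, p)"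
  let ?s = "s(i := VReal (\<omega> p))"
  have "exec \<omega> (Seq (Sample i) (Assign K e)) (s, p) (1 + (1 + cost e)) (?s(K := eval e ?s), Suc p)"
    by (rule exec.Seq[OF exec.Sample exec.Assign])
  then show "\<exists>s' \<tau>. exec \<omega> (Seq (Sample i) (Assign K e)) (s, snd (v, p)) \<tau> (s', snd (v', Suc p)) \<and>
      s' K = fst (v', Suc p) \<and> real \<tau> \<le> b"
    using assms(1)[of ?s] assms(2,3) s
    by (intro exI[of _ "?s(K := eval e ?s)"] exI[of _ "1 + (1 + cost e)"]) auto
qed

lemma steps_seq:
  assumes "steps \<omega> K P a b a'" "steps \<omega> K P' a' b' a''" "b + b' \<le> b''"
  shows "steps \<omega> K (Seq P P') a b'' a''"
  unfolding steps_def
proof (intro allI impI)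
  fix s :: "nat \<Rightarrow> val" assume "s K = fst a"
  then obtain s1 \<tau>1 where 1: "exec \<omega> P (s, snd a) \<tau>1 (s1, snd a')" "s1 K = fst a'" "real \<tau>1 \<le> b"
    using assms(1) unfolding steps_def by blast
  obtain s2 \<tau>2 where 2: "exec \<omega> P' (s1, snd a') \<tau>2 (s2, snd a'')" "s2 K = fst a''" "real \<tau>2 \<le> b'"
    using assms(2) 1 unfolding steps_def by blast
  show "\<exists>s' \<tau>. exec \<omega> (Seq P P') (s, snd a) \<tau> (s', snd a'') \<and> s' K = fst a'' \<and> real \<tau> \<le> b''"
    using exec.Seq[OF 1(1) 2(1)] 1 2 assms(3)
    by (intro exI[of _ s2] exI[of _ "\<tau>1 + \<tau>2"]) auto
qed

lemma steps_cond:
  assumes "\<And>s. s K = v \<Longrightarrow> eval e s = enc_bool g" "steps \<omega> K (if g then P else P') (v, p) b a'"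
    "1 + real (cost e) + b \<le> b'"
  shows "steps \<omega> K (Cond e P P') (v, p) b' a'"
  unfolding steps_def
proof (intro allI impI)
  fix s :: "nat \<Rightarrow> val" assume s: "s K = fst (v, p)"
  then obtain s1 \<tau>1 where 1: "exec \<omega> (if g then P else P') (s, p) \<tau>1 (s1, snd a')"
      "s1 K = fst a'" "real \<tau>1 \<le> b"
    using assms(2) unfolding steps_def by auto
  have "exec \<omega> (Cond e P P') (s, p) (1 + cost e + \<tau>1) (s1, snd a')"
    using exec.CondTrue[of e s \<omega> P p \<tau>1 "(s1, snd a')" P']
      exec.CondFalse[of e s \<omega> P' p \<tau>1 "(s1, snd a')" P] 1(1) assms(1)[of s] s
    by (cases g) (simp_all add: enc_bool_def)
  then show "\<exists>s' \<tau>. exec \<omega> (Cond e P P') (s, snd (v, p)) \<tau> (s', snd a') \<and>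
      s' K = fst a' \<and> real \<tau> \<le> b'"
    using 1 assms(3) by (intro exI[of _ s1] exI[of _ "1 + cost e + \<tau>1"]) auto
qed

lemma steps_while_false:
  assumes "\<And>s. s K = v \<Longrightarrow> eval e s = VReal 0" "1 + real (cost e) \<le> b"
  shows "steps \<omega> K (While e P) (v, p) b (v, p)"
  unfolding steps_def
proof (intro allI impI)
  fix s :: "nat \<Rightarrow> val" assume s: "s K = fst (v, p)"
  then show "\<exists>s' \<tau>. exec \<omega> (While e P) (s, snd (v, p)) \<tau> (s', snd (v, p)) \<and>
      s' K = fst (v, p) \<and> real \<tau> \<le> b"
    using exec.WhileFalse[of e s \<omega> P p] assms
    by (intro exI[of _ s] exI[of _ "1 + cost e"]) auto
qed

lemma steps_while_true:
  assumes "\<And>s. s K = v \<Longrightarrow> eval e s = VReal 1" "steps \<omega> K P (v, p) b a'"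
    "steps \<omega> K (While e P) a' b' a''" "1 + real (cost e) + b + b' \<le> b''"
  shows "steps \<omega> K (While e P) (v, p) b'' a''"
  unfolding steps_def
proof (intro allI impI)
  fix s :: "nat \<Rightarrow> val" assume s: "s K = fst (v, p)"
  then obtain s1 \<tau>1 where 1: "exec \<omega> P (s, p) \<tau>1 (s1, snd a')" "s1 K = fst a'" "real \<tau>1 \<le> b"
    using assms(2) unfolding steps_def by auto
  obtain s2 \<tau>2 where 2: "exec \<omega> (While e P) (s1, snd a') \<tau>2 (s2, snd a'')"
      "s2 K = fst a''" "real \<tau>2 \<le> b'"
    using assms(3) 1 unfolding steps_def by blast
  show "\<exists>s' \<tau>. exec \<omega> (While e P) (s, snd (v, p)) \<tau> (s', snd a'') \<and>
      s' K = fst a'' \<and> real \<tau> \<le> b''"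
    using exec.WhileTrue[OF _ 1(1) 2(1)] 1 2 assms(1)[of s] s assms(4)
    by (intro exI[of _ s2] exI[of _ "1 + cost e + \<tau>1 + \<tau>2"]) auto
qed

text \<open>The invariant is indexed by the number of consumed elements, and the body itself removes
  the head of the list. Each test of the guard costs 4. All loops of the sanitizer are instances of
  this scheme.\<close>

lemma steps_foreach:
  assumes "\<And>i l. i < length vs \<Longrightarrow>
    steps \<omega> K P (VPair (VPair (vs ! i) l) (st i), pos i) b (VPair l (st (Suc i)), pos (Suc i))"
  shows "steps \<omega> K (While (IsPair (First (Var K))) P) (VPair (enc_list vs) (st 0), pos 0)
    (real (length vs) * (b + 4) + 4) (VPair VNil (st (length vs)), pos (length vs))"
  using assms
proof (induction vs arbitrary: st pos)
  case Nil
  have "steps \<omega> K (While (IsPair (First (Var K))) P) (VPair VNil (st 0), pos 0) 4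
      (VPair VNil (st 0), pos 0)"
    by (rule steps_while_false) (auto simp: enc_bool_def)
  then show ?case by simp
next
  case (Cons v vs)
  have "steps \<omega> K (While (IsPair (First (Var K))) P) (VPair (enc_list vs) (st (Suc 0)), pos (Suc 0))
    (real (length vs) * (b + 4) + 4)
    (VPair VNil (st (Suc (length vs))), pos (Suc (length vs)))"
    using Cons.prems[of "Suc i" for i]
    by (intro Cons.IH[of "\<lambda>i. st (Suc i)" "\<lambda>i. pos (Suc i)"]) auto
  from steps_while_true[OF _ Cons.prems[of 0] this] show ?case
    by (auto simp: enc_bool_def algebra_simps)
qed

section \<open>Calling a deterministic subroutine\<close>

primrec reset :: "nat \<Rightarrow> prog" where
  "reset 0 = Assign 0 Empty"
| "reset (Suc k) = Seq (reset k) (Assign k Empty)"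

text \<open>The language has no empty program, so the base case clears variable 0, hence the
  disjunct \<open>i = 0\<close>. This is harmless because a call stores its input there
  next.\<close>

lemma exec_reset:
  "exec \<omega> (reset k) (s, p) (2 * k + 2) (\<lambda>i. if i < k \<or> i = 0 then VNil else s i, p)"
proof (induction k)
  case 0
  have "exec \<omega> (Assign 0 Empty) (s, p) (1 + cost Empty) (s(0 := eval Empty s), p)"
    by (rule exec.Assign)
  also have "s(0 := eval Empty s) = (\<lambda>i. if i < 0 \<or> i = 0 then VNil else s i)" by auto
  finally show ?case by simp
next
  case (Suc k)
  let ?s = "\<lambda>i. if i < k \<or> i = 0 then VNil else s i"
  have "exec \<omega> (reset (Suc k)) (s, p) (2 * k + 2 + (1 + cost Empty)) (?s(k := eval Empty ?s), p)"
    unfolding reset.simps by (rule exec.Seq[OF Suc exec.Assign])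
  also have "?s(k := eval Empty ?s) = (\<lambda>i. if i < Suc k \<or> i = 0 then VNil else s i)" by auto
  finally show ?case by simp
qed

text \<open>\<open>B\<close> expects blank variables, so its variables are cleared before each call; the caller keeps its
  whole state in a single variable \<open>K\<close> above those of \<open>B\<close>.\<close>

definition call :: "prog \<Rightarrow> nat \<Rightarrow> expr \<Rightarrow> expr \<Rightarrow> prog" where
  "call B K e e' = Seq (reset K) (Seq (Assign 0 e) (Seq B (Assign K e')))"

lemma steps_call:
  assumes "runs_within \<omega> B inp out b" "deterministic B" "prog_bound B \<le> K" "0 < K"
    and "\<And>s. s K = v \<Longrightarrow> eval e s = inp" "\<And>s. s K = v \<Longrightarrow> s 0 = out \<Longrightarrow> eval e' s = v'"
    and "4 + 2 * real K + real (cost e) + b + real (cost e') \<le> b'"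
  shows "steps \<omega> K (call B K e e') (v, p) b' (v', p)"
  unfolding steps_def
proof (intro allI impI)
  fix s :: "nat \<Rightarrow> val" assume "s K = fst (v, p)"
  then have sK: "s K = v" by simp
  obtain \<tau> u q where B: "exec \<omega> B ((\<lambda>_. VNil)(0 := inp), 0) \<tau> (u, q)" "u 0 = out" "real \<tau> \<le> b"
    using assms(1) unfolding runs_within_def by auto
  define s1 where "s1 = (\<lambda>i. if i < K \<or> i = 0 then VNil else s i)"
  have s1K: "s1 K = v" using sK assms(4) by (simp add: s1_def)
  define s2 where "s2 = s1(0 := eval e s1)"
  have s2: "s2 i = ((\<lambda>_. VNil)(0 := inp)) i" if "i < K" for i
    using that assms(5)[of s1, OF s1K] by (auto simp: s2_def s1_def)
  \<comment> \<open>\<open>B\<close> is replayed from the actual head position \<open>p\<close> and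
    from a store that is blank only below \<open>K\<close>, so the state of the caller in
    \<open>K\<close> survives.\<close>
  obtain s3 where s3: "exec \<omega> B (s2, p) \<tau> (s3, p)" "\<forall>i<K. s3 i = u i" "\<forall>i\<ge>K. s3 i = s2 i"
    using exec_frame[OF B(1) assms(2,3), of s2 p] s2 by auto
  have s3K: "s3 K = v" "s3 0 = out" using s3 s1K assms(4) B(2) by (auto simp: s2_def)
  have 1: "exec \<omega> (reset K) (s, p) (2 * K + 2) (s1, p)"
    unfolding s1_def by (rule exec_reset)
  have 2: "exec \<omega> (Assign 0 e) (s1, p) (1 + cost e) (s2, p)"
    unfolding s2_def by (rule exec.Assign)
  have "exec \<omega> (call B K e e') (s, p) (2 * K + 2 + ((1 + cost e) + (\<tau> + (1 + cost e'))))
      (s3(K := eval e' s3), p)"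
    unfolding call_def
    by (rule exec.Seq[OF 1 exec.Seq[OF 2 exec.Seq[OF s3(1) exec.Assign]]])
  then show "\<exists>s' \<tau>. exec \<omega> (call B K e e') (s, snd (v, p)) \<tau> (s', snd (v', p)) \<and>
      s' K = fst (v', p) \<and> real \<tau> \<le> b'"
    using assms(6)[of s3, OF s3K] assms(7) B(3) sK
    by (intro exI conjI) (assumption | simp)+
qed

lemma runs_within_stepsI:
  assumes "steps \<omega> 0 P (inp, 0) b (out, p)"
  shows "runs_within \<omega> P inp out b"
  using assms[unfolded steps_def, rule_format, of "(\<lambda>_. VNil)(0 := inp)"]
  unfolding runs_within_def by auto

lemma runs_within_wrapI:
  assumes "steps \<omega> K P (inp, 0) b (v, p)" "\<And>s. s K = v \<Longrightarrow> eval e s = out"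
    "b + 3 + real (cost e) \<le> b'"
  shows "runs_within \<omega> (Seq (Assign K (Var 0)) (Seq P (Assign 0 e))) inp out b'"
proof -
  let ?s = "(\<lambda>_. VNil)(0 := inp)"
  let ?s1 = "?s(K := eval (Var 0) ?s)"
  obtain s2 \<tau> where 2: "exec \<omega> P (?s1, 0) \<tau> (s2, p)" "s2 K = v" "real \<tau> \<le> b"
    using assms(1)[unfolded steps_def, rule_format, of ?s1] by auto
  have "exec \<omega> (Seq (Assign K (Var 0)) (Seq P (Assign 0 e))) (?s, 0)
      ((1 + cost (Var 0)) + (\<tau> + (1 + cost e))) (s2(0 := eval e s2), p)"
    by (intro exec.Seq[OF exec.Assign] exec.Seq[OF 2(1)] exec.Assign)
  then show ?thesis
    unfolding runs_within_def using 2 assms(2)[of s2] assms(3)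
    by (intro exI conjI) (assumption | simp)+
qed

section \<open>Composition of privacy losses\<close>

lemma sinh_le_mult_cosh:
  fixes x :: real
  assumes "0 \<le> x"
  shows "sinh x \<le> x * cosh x"
proof -
  have "0 * cosh 0 - sinh 0 \<le> x * cosh x - sinh (x :: real)"
  proof (rule DERIV_nonneg_imp_nondecreasing[OF assms])
    fix t :: real assume "0 \<le> t"
    then show "\<exists>y. ((\<lambda>t. t * cosh t - sinh t) has_real_derivative y) (at t) \<and> 0 \<le> y"
      by (intro exI[of _ "t * sinh t"]) (auto intro!: derivative_eq_intros)
  qed
  then show ?thesis by simp
qed

text \<open>The derivative of \<open>ln (cosh t)\<close> is \<open>tanh t \<le> t\<close>, so
  \<open>cosh t * exp (- t\<^sup>2 / 2)\<close> does not increase on the nonnegative axis.\<close>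

lemma cosh_le_exp_mult_cosh:
  fixes x y :: real
  assumes "0 \<le> y" "y \<le> x"
  shows "cosh x \<le> exp ((x\<^sup>2 - y\<^sup>2) / 2) * cosh y"
proof -
  have "cosh x * exp (- x\<^sup>2 / 2) \<le> cosh y * exp (- y\<^sup>2 / 2)"
  proof (rule DERIV_nonpos_imp_nonincreasing[OF assms(2)])
    fix t assume t: "y \<le> t"
    have "((\<lambda>t. cosh t * exp (- t\<^sup>2 / 2)) has_real_derivative
        (sinh t - t * cosh t) * exp (- t\<^sup>2 / 2)) (at t)"
      by (auto intro!: derivative_eq_intros simp: field_simps)
    moreover have "(sinh t - t * cosh t) * exp (- t\<^sup>2 / 2) \<le> 0"
      using sinh_le_mult_cosh[of t] t assms(1) by (intro mult_nonpos_nonneg) auto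
    ultimately show "\<exists>z. ((\<lambda>t. cosh t * exp (- t\<^sup>2 / 2)) has_real_derivative z) (at t) \<and> z \<le> 0"
      by blast
  qed
  then have "cosh x * exp (- x\<^sup>2 / 2) * exp (x\<^sup>2 / 2) \<le> cosh y * exp (- y\<^sup>2 / 2) * exp (x\<^sup>2 / 2)"
    by (rule mult_right_mono) simp
  then show ?thesis by (simp add: mult.assoc exp_add[symmetric] diff_divide_distrib algebra_simps)
qed

text \<open>The left side is the chord of \<open>x powr \<alpha>\<close> between
  \<open>exp (- \<eta>)\<close> and \<open>exp \<eta>\<close>, taken at 1: the moment of the
  two-point density with these values and mean 1. In the half exponents \<open>u\<close> and
  \<open>v\<close> it becomes a rational identity.\<close>

lemma chord_eq_cosh:
  fixes \<alpha> \<eta> :: real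
  assumes "0 < \<eta>"
  shows "(exp (\<alpha> * \<eta>) - exp (- (\<alpha> * \<eta>))) / (exp \<eta> - exp (- \<eta>)) * (1 - exp (- \<eta>)) + exp (- (\<alpha> * \<eta>))
    = cosh ((\<alpha> - 1 / 2) * \<eta>) / cosh (\<eta> / 2)"
proof -
  define u v where "u = exp (\<eta> / 2)" and "v = exp ((\<alpha> - 1 / 2) * \<eta>)"
  have pos: "u > 1" "v > 0" using assms by (auto simp: u_def v_def)
  have e: "exp \<eta> = u * u" "exp (- \<eta>) = 1 / (u * u)" "exp (\<alpha> * \<eta>) = v * u"
    "exp (- (\<alpha> * \<eta>)) = 1 / (v * u)"
    by (simp_all add: u_def v_def exp_add[symmetric] exp_minus field_simps)
  have c: "cosh (\<eta> / 2) = (u + 1 / u) / 2" "cosh ((\<alpha> - 1 / 2) * \<eta>) = (v + 1 / v) / 2"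
    by (simp_all add: cosh_def u_def v_def exp_minus field_simps)
  have ne: "u * u - 1 / (u * u) \<noteq> 0" "u + 1 / u \<noteq> 0"
  proof -
    have "1 < u * u" using pos by (simp add: less_1_mult)
    moreover from this have "1 / (u * u) < 1" by simp
    ultimately show "u * u - 1 / (u * u) \<noteq> 0" by linarith
    show "u + 1 / u \<noteq> 0" using pos by (simp add: add_pos_pos less_imp_neq[symmetric])
  qed
  have fac: "u * u - 1 / (u * u) = (u + 1 / u) * (u - 1 / u)"
    using pos by (simp add: field_simps)
  have d: "u - 1 / u \<noteq> 0" using fac ne by auto
  \<comment> \<open>The common factor \<open>u - 1 / u\<close> cancels. Abstract numbers keep the
    simplifier from multiplying out the quotients.\<close>
  have *: "p / (a * b) * q + r = c / a"
    if "a \<noteq> 0" "b \<noteq> 0" "p * q + r * (a * b) = c * b" for a b c p q r :: real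
  proof -
    have "p / (a * b) * q + r = (p * q + r * (a * b)) / (a * b)"
      using that(1,2) by (simp add: add_divide_distrib)
    then show ?thesis using that by simp
  qed
  have "(v * u - 1 / (v * u)) * (1 - 1 / (u * u)) + (1 / (v * u)) * ((u + 1 / u) * (u - 1 / u))
      = (v + 1 / v) * (u - 1 / u)"
    using pos by (simp add: field_simps)
  then have "(v * u - 1 / (v * u)) / ((u + 1 / u) * (u - 1 / u)) * (1 - 1 / (u * u)) + 1 / (v * u)
      = (v + 1 / v) / (u + 1 / u)"
    by (rule *[OF ne(2) d])
  moreover have "(p / 2) / (q / 2) = p / q" for p q :: real by simp
  ultimately show ?thesis unfolding e c fac by (simp only:)
qed

text \<open>By convexity of \<open>x powr (1 + \<kappa>)\<close>, the extreme case among densities with values in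
  \<open>[exp (- \<eta>), exp \<eta>]\<close> is the two-point one, whose moment is a quotient of hyperbolic cosines.\<close>

lemma (in prob_space) moment_bound:
  fixes w :: "'a \<Rightarrow> real"
  assumes [measurable]: "w \<in> borel_measurable M"
    and w: "\<And>x. exp (- \<eta>) \<le> w x" "\<And>x. w x \<le> exp \<eta>"
    and "(\<integral>\<^sup>+ x. w x \<partial>M) = 1" "0 < \<eta>" "0 \<le> \<kappa>"
  shows "(\<integral>\<^sup>+ x. w x powr (1 + \<kappa>) \<partial>M) \<le> exp (\<kappa> * (\<kappa> + 1) * \<eta>\<^sup>2 / 2)"
proof -
  define c where "c = (exp ((1 + \<kappa>) * \<eta>) - exp (- ((1 + \<kappa>) * \<eta>))) / (exp \<eta> - exp (- \<eta>))"
  have wpos: "0 < w x" for x using w(1)[of x] by (meson exp_gt_zero less_le_trans)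
  have conv: "convex_on {exp (- \<eta>)..exp \<eta>} (\<lambda>x. x powr (1 + \<kappa>))"
    by (rule convex_on_subset[OF powr_convex]) (use assms(6) in \<open>auto simp: less_le_trans[OF exp_gt_zero]\<close>)
  have chord: "w x powr (1 + \<kappa>) \<le> c * (w x - exp (- \<eta>)) + exp (- ((1 + \<kappa>) * \<eta>))" for x
    using convex_onD_Icc'[OF conv, of "w x"] w[of x]
    by (simp add: c_def powr_def mult.commute)
  have int: "integrable M w"
    using w wpos by (intro integrable_const_bound[of _ "exp \<eta>"]) (auto simp: abs_of_pos)
  have Ew: "expectation w = 1"
    using assms(4) wpos by (subst integral_eq_nn_integral) (auto simp: less_imp_le)
  have "w x powr (1 + \<kappa>) \<le> exp \<eta> powr (1 + \<kappa>)" for x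
    using w(2)[of x] wpos[of x] assms(6) by (intro powr_mono2) auto
  then have intp: "integrable M (\<lambda>x. w x powr (1 + \<kappa>))"
    by (intro integrable_const_bound[of _ "exp \<eta> powr (1 + \<kappa>)"]) auto
  have "expectation (\<lambda>x. w x powr (1 + \<kappa>)) \<le>
      expectation (\<lambda>x. c * (w x - exp (- \<eta>)) + exp (- ((1 + \<kappa>) * \<eta>)))"
    using int intp chord by (intro integral_mono) auto
  also have "\<dots> = c * (1 - exp (- \<eta>)) + exp (- ((1 + \<kappa>) * \<eta>))"
    using int Ew by (simp add: prob_space)
  also have "\<dots> = cosh ((1 + \<kappa> - 1 / 2) * \<eta>) / cosh (\<eta> / 2)"
    unfolding c_def by (rule chord_eq_cosh[OF assms(5)])
  \<comment> \<open>Since \<open>\<kappa> \<ge> 0\<close>, the larger argument is at least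
    \<open>\<eta> / 2\<close>; the difference of squares collapses because
    \<open>(\<kappa> + 1/2)\<^sup>2 - 1/4 = \<kappa> * (\<kappa> + 1)\<close>.\<close>
  also have "\<dots> \<le> exp ((((1 + \<kappa> - 1 / 2) * \<eta>)\<^sup>2 - (\<eta> / 2)\<^sup>2) / 2)"
    using cosh_le_exp_mult_cosh[of "\<eta> / 2" "(1 + \<kappa> - 1 / 2) * \<eta>"] assms(5,6)
    by (simp add: divide_le_eq cosh_real_pos mult_right_mono algebra_simps)
  also have "(((1 + \<kappa> - 1 / 2) * \<eta>)\<^sup>2 - (\<eta> / 2)\<^sup>2) / 2 = \<kappa> * (\<kappa> + 1) * \<eta>\<^sup>2 / 2"
    by (simp add: power2_eq_square field_simps)
  finally have "expectation (\<lambda>x. w x powr (1 + \<kappa>)) \<le> exp (\<kappa> * (\<kappa> + 1) * \<eta>\<^sup>2 / 2)" .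
  then show ?thesis
    by (subst nn_integral_eq_integral[OF intp]) (auto simp: ennreal_leI)
qed

section \<open>Products of densities and composition\<close>

lemma PiM_density:
  assumes "finite I" "\<And>i. sigma_finite_measure (M i)"
    and [measurable]: "\<And>i. f i \<in> borel_measurable (M i)"
    and "\<And>i. sigma_finite_measure (density (M i) (f i))"
  shows "PiM I (\<lambda>i. density (M i) (f i)) = density (PiM I M) (\<lambda>x. \<Prod>i\<in>I. f i (x i))"
proof -
  interpret M: product_sigma_finite M using assms(2) by (simp add: product_sigma_finite_def)
  interpret D: product_sigma_finite "\<lambda>i. density (M i) (f i)"
    using assms(4) by (simp add: product_sigma_finite_def)
  have meas: "(\<lambda>x. \<Prod>i\<in>I. f i (x i)) \<in> borel_measurable (PiM I M)"
    by (intro borel_measurable_prod_ennreal) measurable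
  show ?thesis
  proof (rule D.PiM_eqI[symmetric])
    show "sets (density (PiM I M) (\<lambda>x. \<Prod>i\<in>I. f i (x i))) = sets (PiM I (\<lambda>i. density (M i) (f i)))"
      by (simp cong: sets_PiM_cong)
    fix A assume A: "\<And>i. i \<in> I \<Longrightarrow> A i \<in> sets (density (M i) (f i))"
    then have PA: "Pi\<^sub>E I A \<in> sets (PiM I M)" using assms(1) by (intro sets_PiM_I_finite) auto
    have "emeasure (density (PiM I M) (\<lambda>x. \<Prod>i\<in>I. f i (x i))) (Pi\<^sub>E I A)
        = (\<integral>\<^sup>+ x. (\<Prod>i\<in>I. f i (x i)) * indicator (Pi\<^sub>E I A) x \<partial>PiM I M)"
      by (rule emeasure_density[OF meas PA])
    also have "\<dots> = (\<integral>\<^sup>+ x. (\<Prod>i\<in>I. f i (x i) * indicator (A i) (x i)) \<partial>PiM I M)"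
    proof (rule nn_integral_cong)
      fix x assume x: "x \<in> space (PiM I M)"
      show "(\<Prod>i\<in>I. f i (x i)) * indicator (Pi\<^sub>E I A) x = (\<Prod>i\<in>I. f i (x i) * indicator (A i) (x i))"
      proof (cases "x \<in> Pi\<^sub>E I A")
        case True
        then show ?thesis by (auto intro!: prod.cong simp: indicator_def PiE_iff)
      next
        case False
        then obtain i where "i \<in> I" "x i \<notin> A i" using x by (auto simp: space_PiM PiE_iff)
        then have "(\<Prod>i\<in>I. f i (x i) * indicator (A i) (x i)) = 0"
          using assms(1) by (intro prod_zero) (auto intro!: bexI[of _ i])
        then show ?thesis using False by simp
      qed
    qed
    also have "\<dots> = (\<Prod>i\<in>I. \<integral>\<^sup>+ x. f i x * indicator (A i) x \<partial>M i)"
    proof (rule M.product_nn_integral_prod[OF assms(1)])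
      fix i assume "i \<in> I"
      then have [measurable]: "A i \<in> sets (M i)" using A by simp
      show "(\<lambda>x. f i x * indicator (A i) x) \<in> borel_measurable (M i)" by measurable
    qed
    also have "\<dots> = (\<Prod>i\<in>I. emeasure (density (M i) (f i)) (A i))"
      using A by (intro prod.cong refl) (simp add: emeasure_density)
    finally show "emeasure (density (PiM I M) (\<lambda>x. \<Prod>i\<in>I. f i (x i))) (Pi\<^sub>E I A) =
      (\<Prod>i\<in>I. emeasure (density (M i) (f i)) (A i))" .
  qed (fact assms(1))
qed

text \<open>The density \<open>W\<close> of the product satisfies \<open>W \<le> exp \<epsilon> + exp (- \<kappa> * \<epsilon>) * W powr (1 + \<kappa>)\<close>.\<close>

lemma advanced_composition:
  fixes M :: "'i \<Rightarrow> 'a measure" and w :: "'i \<Rightarrow> 'a \<Rightarrow> real"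
  assumes I: "finite I" and M: "\<And>i. prob_space (M i)"
    and [measurable]: "\<And>i. w i \<in> borel_measurable (M i)"
    and w: "\<And>i x. exp (- \<eta>) \<le> w i x" "\<And>i x. w i x \<le> exp \<eta>"
    and D: "\<And>i. prob_space (density (M i) (w i))"
    and pos: "0 < \<eta>" "0 \<le> \<kappa>" and S: "S \<in> sets (PiM I M)"
  shows "measure (PiM I (\<lambda>i. density (M i) (w i))) S \<le>
    exp \<epsilon> * measure (PiM I M) S + exp (real (card I) * (\<kappa> * (\<kappa> + 1) * \<eta>\<^sup>2 / 2) - \<kappa> * \<epsilon>)"
proof -
  interpret P: product_sigma_finite M
    using M by (simp add: product_sigma_finite_def prob_space_imp_sigma_finite)
  interpret PP: prob_space "PiM I M" by (rule prob_space_PiM) (rule M)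
  interpret DD: prob_space "PiM I (\<lambda>i. density (M i) (w i))" by (rule prob_space_PiM) (rule D)
  have wpos: "0 < w i x" for i x using w(1)[of i x] by (meson exp_gt_zero less_le_trans)
  define W where "W x = (\<Prod>i\<in>I. w i (x i))" for x
  have Wpos: "0 < W x" for x unfolding W_def by (rule prod_pos) (use wpos in auto)
  have Wm: "(\<lambda>x. \<Prod>i\<in>I. ennreal (w i (x i) powr p)) \<in> borel_measurable (PiM I M)" for p
    by (intro borel_measurable_prod_ennreal) measurable
  have dens: "PiM I (\<lambda>i. density (M i) (w i)) = density (PiM I M) (\<lambda>x. ennreal (W x))"
    using I M D wpos by (subst PiM_density)
      (auto simp: W_def prod_ennreal less_imp_le prob_space_imp_sigma_finite)
  have Wpowr: "ennreal (W x powr p) = (\<Prod>i\<in>I. ennreal (w i (x i) powr p))" for x p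
    using wpos unfolding W_def by (simp add: prod_powr_distrib prod_ennreal less_imp_le)
  have [measurable]: "(\<lambda>x. ennreal (W x powr p)) \<in> borel_measurable (PiM I M)" for p
    unfolding Wpowr by (rule Wm)
  \<comment> \<open>Exponent 1 turns the measurability of the powers into that of \<open>W\<close>
    itself; this uses \<open>W x > 0\<close>.\<close>
  have W1: "W x = W x powr 1" for x using Wpos[of x] by simp
  have [measurable]: "(\<lambda>x. ennreal (W x)) \<in> borel_measurable (PiM I M)"
    by (subst W1) measurable
  have bound: "W x \<le> exp \<epsilon> + exp (- (\<kappa> * \<epsilon>)) * W x powr (1 + \<kappa>)" for x
  proof (cases "W x \<le> exp \<epsilon>")
    case False
    \<comment> \<open>Markov's argument pointwise: beyond \<open>exp \<epsilon>\<close> this factor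
      is at least 1 and can be multiplied in.\<close>
    have "1 \<le> (W x * exp (- \<epsilon>)) powr \<kappa>"
      using False pos by (intro ge_one_powr_ge_zero) (simp_all add: exp_minus field_simps)
    also have "\<dots> = W x powr \<kappa> * exp (- (\<kappa> * \<epsilon>))"
      using Wpos[of x] by (simp add: powr_mult less_imp_le) (simp add: powr_def)
    finally have "W x * 1 \<le> W x * (W x powr \<kappa> * exp (- (\<kappa> * \<epsilon>)))"
      using Wpos[of x] by (intro mult_left_mono) auto
    also have "\<dots> = exp (- (\<kappa> * \<epsilon>)) * W x powr (1 + \<kappa>)"
      using Wpos[of x] by (simp add: powr_add)
    also have "\<dots> \<le> exp \<epsilon> + \<dots>" by simp
    finally show ?thesis by simp
  qed (use Wpos[of x] in \<open>simp add: add_increasing2\<close>)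
  have mom: "(\<integral>\<^sup>+ x. w i x powr (1 + \<kappa>) \<partial>M i) \<le> ennreal (exp (\<kappa> * (\<kappa> + 1) * \<eta>\<^sup>2 / 2))" for i
  proof -
    interpret prob_space "M i" by (rule M)
    have "(\<integral>\<^sup>+ x. w i x \<partial>M i) = 1"
      using prob_space.emeasure_space_1[OF D[of i]] by (simp add: emeasure_density cong: nn_integral_cong)
    then show ?thesis using w pos by (intro moment_bound) auto
  qed
  have "emeasure (PiM I (\<lambda>i. density (M i) (w i))) S = (\<integral>\<^sup>+ x. ennreal (W x) * indicator S x \<partial>PiM I M)"
    unfolding dens using S by (simp add: emeasure_density)
  \<comment> \<open>The second term drops the indicator: over the whole space its integral is a
    moment and factors over the coordinates.\<close>
  also have "\<dots> \<le> (\<integral>\<^sup>+ x. ennreal (exp \<epsilon>) * indicator S x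
      + ennreal (exp (- (\<kappa> * \<epsilon>))) * ennreal (W x powr (1 + \<kappa>)) \<partial>PiM I M)"
  proof (rule nn_integral_mono)
    fix x
    show "ennreal (W x) * indicator S x \<le> ennreal (exp \<epsilon>) * indicator S x
      + ennreal (exp (- (\<kappa> * \<epsilon>))) * ennreal (W x powr (1 + \<kappa>))"
      using bound[of x]
      by (auto simp: indicator_def ennreal_mult[symmetric] ennreal_plus[symmetric]
          simp del: ennreal_plus intro!: ennreal_leI)
  qed
  also have "\<dots> = ennreal (exp \<epsilon>) * emeasure (PiM I M) S +
      ennreal (exp (- (\<kappa> * \<epsilon>))) * (\<integral>\<^sup>+ x. ennreal (W x powr (1 + \<kappa>)) \<partial>PiM I M)"
    using S by (subst nn_integral_add, measurable, subst nn_integral_cmult, measurable)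
      (simp add: nn_integral_cmult_indicator)
  also have "(\<integral>\<^sup>+ x. ennreal (W x powr (1 + \<kappa>)) \<partial>PiM I M)
      = (\<Prod>i\<in>I. \<integral>\<^sup>+ x. w i x powr (1 + \<kappa>) \<partial>M i)"
    unfolding Wpowr by (rule P.product_nn_integral_prod[OF I]) measurable
  also have "\<dots> \<le> (\<Prod>i\<in>I. ennreal (exp (\<kappa> * (\<kappa> + 1) * \<eta>\<^sup>2 / 2)))"
    using I by (induction rule: finite_induct) (auto intro: mult_mono mom)
  also have "\<dots> = ennreal (exp (real (card I) * (\<kappa> * (\<kappa> + 1) * \<eta>\<^sup>2 / 2)))"
    by (simp add: ennreal_power exp_of_nat_mult[symmetric])
  finally have "emeasure (PiM I (\<lambda>i. density (M i) (w i))) S \<le>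
      ennreal (exp \<epsilon>) * emeasure (PiM I M) S +
      ennreal (exp (- (\<kappa> * \<epsilon>))) * ennreal (exp (real (card I) * (\<kappa> * (\<kappa> + 1) * \<eta>\<^sup>2 / 2)))"
    by (simp add: add_left_mono mult_left_mono)
  then show ?thesis
    by (simp add: PP.emeasure_eq_measure DD.emeasure_eq_measure ennreal_mult[symmetric]
        ennreal_plus[symmetric] exp_add[symmetric] algebra_simps del: ennreal_plus)
qed

section \<open>Laplace noise\<close>

definition unif :: "real measure" where
  "unif = uniform_measure lborel {0..1}"

text \<open>The quantile function of the standard Laplace distribution, without a conditional because the
  machine has no conditional expressions. The junk values \<open>ln 0 = 0\<close> at the end points do not matter.\<close>

definition lap :: "real \<Rightarrow> real" where
  "lap u = of_bool (2 * u \<le> 1) * ln (2 * u) - (1 - of_bool (2 * u \<le> 1)) * ln (2 - 2 * u)"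

lemma measurable_lap [measurable]: "lap \<in> borel_measurable borel"
  unfolding lap_def of_bool_def by measurable

lemma prob_space_unif: "prob_space unif"
  unfolding unif_def by (rule prob_space_uniform_measure) auto

lemma sets_unif [simp, measurable_cong]: "sets unif = sets borel"
  by (simp add: unif_def)

lemma nn_integral_unif:
  "f \<in> borel_measurable borel \<Longrightarrow> (\<integral>\<^sup>+ u. f u \<partial>unif) = (\<integral>\<^sup>+ u. f u * indicator {0..1} u \<partial>lborel)"
  unfolding unif_def by (subst nn_integral_uniform_measure) (auto simp: divide_ennreal_def)

lemma emeasure_unif:
  "A \<in> sets borel \<Longrightarrow> emeasure unif A = emeasure lborel ({0..1} \<inter> A)"
  unfolding unif_def by (simp add: divide_ennreal_def)

lemma distributed_minus_ln_unif: "distributed unif lborel (\<lambda>u. - ln u) (exponential_density 1)"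
proof (rule exponential_distributedI)
  fix a :: real assume a: "0 \<le> a"
  have e: "exp (- a) \<le> 1" using a by simp
  have "emeasure unif {u \<in> space unif. - ln u \<le> a} = emeasure unif {u. - ln u \<le> a}"
    by (simp add: unif_def)
  also have "\<dots> = emeasure lborel ({0..1} \<inter> {u. - ln u \<le> a})"
    by (rule emeasure_unif) measurable
  \<comment> \<open>The point 0 is extra because \<open>ln 0 = 0 \<ge> - a\<close>; it has measure
    zero.\<close>
  also have "{0..1} \<inter> {u. - ln u \<le> a} = insert 0 {exp (- a)..1}"
  proof (intro set_eqI iffI)
    fix u assume "u \<in> {0..1} \<inter> {u. - ln u \<le> a}"
    then have u: "0 \<le> u" "u \<le> 1" "- a \<le> ln u" by auto
    show "u \<in> insert 0 {exp (- a)..1}"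
    proof (cases "u = 0")
      case False
      then show ?thesis using u ln_ge_iff[of u "- a"] by auto
    qed simp
  next
    fix u assume u: "u \<in> insert 0 {exp (- a)..1}"
    show "u \<in> {0..1} \<inter> {u. - ln u \<le> a}"
    proof (cases "u = 0")
      case False
      then have "0 < u" "exp (- a) \<le> u" "u \<le> 1" using u by (auto intro: less_le_trans[OF exp_gt_zero])
      then show ?thesis using ln_ge_iff[of u "- a"] by auto
    qed (use a in simp)
  qed
  also have "emeasure lborel (insert 0 {exp (- a)..1}) = emeasure lborel {exp (- a)..1}"
    by (simp add: emeasure_insert)
  also have "\<dots> = 1 - ennreal (exp (- a * 1))"
    using e by (simp add: ennreal_minus ennreal_1[symmetric] del: ennreal_1)
  finally show "emeasure unif {u \<in> space unif. - ln u \<le> a} = 1 - ennreal (exp (- a * 1))" .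
qed (auto simp: unif_def)

text \<open>The substitution \<open>x = - ln u\<close> for arbitrary measurable \<open>g\<close>:
  the distribution function of \<open>- ln u\<close> determines its law, which avoids a change of
  variables in the integral.\<close>

lemma nn_integral_exponential:
  assumes [measurable]: "g \<in> borel_measurable borel"
  shows "(\<integral>\<^sup>+ u. g (- ln u) * indicator {0..1} u \<partial>lborel) =
    (\<integral>\<^sup>+ x. ennreal (exponential_density 1 x) * g x \<partial>lborel)"
proof -
  have "(\<integral>\<^sup>+ x. ennreal (exponential_density 1 x) * g x \<partial>lborel) = (\<integral>\<^sup>+ u. g (- ln u) \<partial>unif)"
    by (rule distributed_nn_integral[OF distributed_minus_ln_unif]) measurable
  also have "\<dots> = (\<integral>\<^sup>+ u. g (- ln u) * indicator {0..1} u \<partial>lborel)"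
    by (rule nn_integral_unif) measurable
  finally show ?thesis ..
qed

text \<open>The substitutions \<open>u = v / 2\<close> and \<open>u = 1 - v / 2\<close> turn the two halves of the unit interval into
  a reflected and an ordinary exponential distribution.\<close>

lemma nn_integral_lap:
  assumes [measurable]: "g \<in> borel_measurable borel"
  shows "(\<integral>\<^sup>+ u. g (lap u) \<partial>unif) = (\<integral>\<^sup>+ x. ennreal (exp (- \<bar>x\<bar>) / 2) * g x \<partial>lborel)"
proof -
  let ?h = "ennreal (1 / 2)"
  let ?e = "\<lambda>x. ennreal (exponential_density 1 x)"
  have nonneg: "0 \<le> exponential_density 1 x" for x by (simp add: exponential_density_def)
  have half: "?h * (ennreal r * y) = ennreal (r / 2) * y" if "0 \<le> r" for r y
  proof -
    have "ennreal (1 / 2 * r) = ?h * ennreal r" using that by (intro ennreal_mult) auto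
    then show ?thesis by (simp only: mult.assoc mult_1 times_divide_eq_left)
  qed
  have "(\<integral>\<^sup>+ u. g (lap u) \<partial>unif) = (\<integral>\<^sup>+ u. g (lap u) * indicator {0..1} u \<partial>lborel)"
    by (rule nn_integral_unif) measurable
  also have "\<dots> = (\<integral>\<^sup>+ u. g (lap u) * indicator {0..1/2} u + g (lap u) * indicator {1/2<..1} u \<partial>lborel)"
    by (rule nn_integral_cong) (auto simp: indicator_def)
  also have "\<dots> = (\<integral>\<^sup>+ u. g (lap u) * indicator {0..1/2} u \<partial>lborel)
      + (\<integral>\<^sup>+ u. g (lap u) * indicator {1/2<..1} u \<partial>lborel)"
    by (rule nn_integral_add) measurable
  also have "(\<integral>\<^sup>+ u. g (lap u) * indicator {0..1/2} u \<partial>lborel)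
      = ?h * (\<integral>\<^sup>+ v. g (lap (0 + 1 / 2 * v)) * indicator {0..1/2} (0 + 1 / 2 * v) \<partial>lborel)"
    by (subst nn_integral_real_affine[where c = "1 / 2" and t = 0]) auto
  also have "(\<integral>\<^sup>+ v. g (lap (0 + 1 / 2 * v)) * indicator {0..1/2} (0 + 1 / 2 * v) \<partial>lborel)
      = (\<integral>\<^sup>+ v. g (- (- ln v)) * indicator {0..1} v \<partial>lborel)"
    by (rule nn_integral_cong) (auto simp: indicator_def lap_def)
  also have "\<dots> = (\<integral>\<^sup>+ x. ?e x * g (- x) \<partial>lborel)"
    by (rule nn_integral_exponential) measurable
  also have "\<dots> = (\<integral>\<^sup>+ x. ?e (- x) * g x \<partial>lborel)"
    by (subst nn_integral_real_affine[where c = "- 1" and t = 0]) auto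
  also have "(\<integral>\<^sup>+ u. g (lap u) * indicator {1/2<..1} u \<partial>lborel)
      = ?h * (\<integral>\<^sup>+ v. g (lap (1 + (- 1 / 2) * v)) * indicator {1/2<..1} (1 + (- 1 / 2) * v) \<partial>lborel)"
    by (subst nn_integral_real_affine[where c = "- 1 / 2" and t = 1]) auto
  also have "(\<integral>\<^sup>+ v. g (lap (1 + (- 1 / 2) * v)) * indicator {1/2<..1} (1 + (- 1 / 2) * v) \<partial>lborel)
      = (\<integral>\<^sup>+ v. g (- ln v) * indicator {0..1} v \<partial>lborel)"
  proof (rule nn_integral_cong_AE)
    show "AE v in lborel. g (lap (1 + (- 1 / 2) * v)) * indicator {1/2<..1} (1 + (- 1 / 2) * v)
        = g (- ln v) * indicator {0..1} v"
      \<comment> \<open>At \<open>v = 1\<close>, that is \<open>u = 1 / 2\<close>, the half-open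
        interval excludes the point while \<open>{0..1}\<close> includes it.\<close>
      using AE_lborel_singleton[of 1] by eventually_elim (auto simp: indicator_def lap_def)
  qed
  also have "\<dots> = (\<integral>\<^sup>+ x. ?e x * g x \<partial>lborel)"
    by (rule nn_integral_exponential) measurable
  also have "?h * (\<integral>\<^sup>+ x. ?e (- x) * g x \<partial>lborel) + ?h * (\<integral>\<^sup>+ x. ?e x * g x \<partial>lborel)
      = (\<integral>\<^sup>+ x. ?h * (?e (- x) * g x) + ?h * (?e x * g x) \<partial>lborel)"
    by (simp add: nn_integral_add nn_integral_cmult)
  also have "\<dots> = (\<integral>\<^sup>+ x. ennreal (exp (- \<bar>x\<bar>) / 2) * g x \<partial>lborel)"
  proof (rule nn_integral_cong_AE)
    show "AE x in lborel. ?h * (?e (- x) * g x) + ?h * (?e x * g x) = ennreal (exp (- \<bar>x\<bar>) / 2) * g x"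
      \<comment> \<open>At 0 both one-sided densities equal 1, so the two halves together give twice
        the Laplace density there.\<close>
      using AE_lborel_singleton[of 0]
      unfolding half[OF nonneg]
      by eventually_elim (auto simp: exponential_density_def abs_if)
  qed
  finally show ?thesis .
qed

lemma distributed_lap: "distributed unif lborel lap (\<lambda>x. ennreal (exp (- \<bar>x\<bar>) / 2))"
  unfolding distributed_def
proof (intro conjI)
  show "distr unif lborel lap = density lborel (\<lambda>x. ennreal (exp (- \<bar>x\<bar>) / 2))"
  proof (rule measure_eqI)
    fix A assume "A \<in> sets (distr unif lborel lap)"
    then have [measurable]: "A \<in> sets borel" by simp
    have "emeasure (distr unif lborel lap) A = (\<integral>\<^sup>+ u. indicator A (lap u) \<partial>unif)"
      using nn_integral_distr[of lap unif lborel "indicator A"] by simp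
    also have "\<dots> = (\<integral>\<^sup>+ x. ennreal (exp (- \<bar>x\<bar>) / 2) * indicator A x \<partial>lborel)"
      by (rule nn_integral_lap) measurable
    finally show "emeasure (distr unif lborel lap) A
        = emeasure (density lborel (\<lambda>x. ennreal (exp (- \<bar>x\<bar>) / 2))) A"
      by (simp add: emeasure_density)
  qed simp
qed auto

section \<open>Shifted Laplace distributions and their products\<close>

definition laplace :: "real \<Rightarrow> real \<Rightarrow> real measure" where
  "laplace a b = distr unif borel (\<lambda>u. a + b * lap u)"

lemma prob_space_laplace: "prob_space (laplace a b)"
  unfolding laplace_def by (rule prob_space.prob_space_distr[OF prob_space_unif]) measurable

lemma sets_laplace [simp, measurable_cong]: "sets (laplace a b) = sets borel"
  by (simp add: laplace_def)

lemma laplace_eq_density: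
  assumes "0 < b"
  shows "laplace a b = density lborel (\<lambda>x. ennreal (exp (- \<bar>(x - a) / b\<bar>) / (2 * b)))"
proof -
  interpret prob_space unif by (rule prob_space_unif)
  have "distr unif lborel (\<lambda>u. a + b * lap u)
      = density lborel (\<lambda>x. ennreal (exp (- \<bar>(x - a) / b\<bar>) / 2) / ennreal \<bar>b\<bar>)"
    using distributed_affine[OF distributed_lap, of b a] assms
    by (simp add: distributed_def)
  moreover have "distr unif lborel (\<lambda>u. a + b * lap u) = laplace a b"
    unfolding laplace_def by (rule distr_cong) auto
  ultimately show ?thesis using assms by (simp add: divide_ennreal)
qed

lemma laplace_shift:
  assumes "0 < b"
  shows "laplace a b = density (laplace a' b) (\<lambda>x. ennreal (exp (\<bar>(x - a') / b\<bar> - \<bar>(x - a) / b\<bar>)))"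
  unfolding laplace_eq_density[OF assms]
  by (subst density_density_eq)
    (use assms in \<open>auto simp: ennreal_mult[symmetric] exp_add[symmetric]\<close>)

lemma laplace_mechanism_private:
  assumes I: "finite I" and b: "0 < b" and \<eta>: "0 < \<eta>" "0 \<le> \<kappa>"
    and sens: "\<And>i. i \<in> I \<Longrightarrow> \<bar>a i - a' i\<bar> \<le> \<eta> * b"
    and S: "S \<in> sets (PiM I (\<lambda>_. borel))"
  shows "measure (PiM I (\<lambda>i. laplace (a i) b)) S \<le>
    exp \<epsilon> * measure (PiM I (\<lambda>i. laplace (a' i) b)) S
    + exp (real (card I) * (\<kappa> * (\<kappa> + 1) * \<eta>\<^sup>2 / 2) - \<kappa> * \<epsilon>)"
proof -
  \<comment> \<open>The composition lemma asks for bounded ratios at every index, but the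
    sensitivity is known only on \<open>I\<close>; outside \<open>I\<close> the two means are made
    equal, which leaves the product unchanged.\<close>
  define c where "c i = (if i \<in> I then a i else a' i)" for i
  define w where "w i x = exp (\<bar>(x - a' i) / b\<bar> - \<bar>(x - c i) / b\<bar>)" for i x
  have D: "density (laplace (a' i) b) (w i) = laplace (c i) b" for i
    unfolding w_def by (rule laplace_shift[OF b, symmetric])
  have "\<bar>\<bar>(x - a' i) / b\<bar> - \<bar>(x - c i) / b\<bar>\<bar> \<le> \<eta>" for i x
  proof -
    have "\<bar>\<bar>(x - a' i) / b\<bar> - \<bar>(x - c i) / b\<bar>\<bar> \<le> \<bar>(x - a' i) / b - (x - c i) / b\<bar>"
      by (rule abs_triangle_ineq3)
    also have "\<dots> = \<bar>c i - a' i\<bar> / b" using b by (simp add: diff_divide_distrib[symmetric])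
    also have "\<dots> \<le> \<eta>" using sens[of i] b \<eta> by (auto simp: c_def divide_le_eq)
    finally show ?thesis .
  qed
  then have "- \<eta> \<le> \<bar>(x - a' i) / b\<bar> - \<bar>(x - c i) / b\<bar>"
      "\<bar>(x - a' i) / b\<bar> - \<bar>(x - c i) / b\<bar> \<le> \<eta>" for i x
    by (meson abs_le_D1 abs_le_D2 minus_le_iff)+
  then have wb: "exp (- \<eta>) \<le> w i x" "w i x \<le> exp \<eta>" for i x
    unfolding w_def exp_le_cancel_iff by auto
  have "measure (PiM I (\<lambda>i. density (laplace (a' i) b) (w i))) S \<le>
    exp \<epsilon> * measure (PiM I (\<lambda>i. laplace (a' i) b)) S
    + exp (real (card I) * (\<kappa> * (\<kappa> + 1) * \<eta>\<^sup>2 / 2) - \<kappa> * \<epsilon>)"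
  proof (rule advanced_composition[OF I])
    show "w i \<in> borel_measurable (laplace (a' i) b)" for i
      unfolding w_def by measurable
    show "S \<in> sets (PiM I (\<lambda>i. laplace (a' i) b))"
      using S by (simp cong: sets_PiM_cong)
  qed (use wb \<eta> prob_space_laplace in \<open>auto simp: D\<close>)
  moreover have "PiM I (\<lambda>i. density (laplace (a' i) b) (w i)) = PiM I (\<lambda>i. laplace (a i) b)"
    unfolding D by (rule PiM_cong) (auto simp: c_def)
  ultimately show ?thesis by simp
qed

section \<open>Independence of the tape cells and tails of the noise\<close>

lemma tape_eq: "tape = PiM UNIV (\<lambda>_. unif)"
  unfolding tape_def unif_def ..

lemma prob_space_tape: "prob_space tape"
  unfolding tape_eq by (rule prob_space_PiM) (rule prob_space_unif)

lemma measurable_tape_component: "(\<lambda>\<omega>. \<omega> i) \<in> borel_measurable tape"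
  unfolding tape_eq by measurable

text \<open>Coordinate \<open>j\<close> reads tape cell \<open>j\<close> only, so the law factors on
  boxes, which determine a finite product measure. The privacy analysis can then leave the machine
  behind.\<close>

lemma distr_tape:
  fixes g :: "nat \<Rightarrow> real \<Rightarrow> real"
  assumes [measurable]: "\<And>j. g j \<in> borel_measurable borel"
  shows "distr tape (PiM {..<N} (\<lambda>_. borel)) (\<lambda>\<omega>. \<lambda>j\<in>{..<N}. g j (\<omega> j))
    = PiM {..<N} (\<lambda>j. distr unif borel (g j))"
proof -
  have p: "prob_space (distr unif borel (g j))" for j
    by (rule prob_space.prob_space_distr[OF prob_space_unif]) measurable
  interpret product_sigma_finite "\<lambda>j. distr unif borel (g j)"
    by (simp add: product_sigma_finite_def prob_space_imp_sigma_finite p)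
  have M: "(\<lambda>\<omega>. \<lambda>j\<in>{..<N}. g j (\<omega> j)) \<in> tape \<rightarrow>\<^sub>M PiM {..<N} (\<lambda>_. borel)"
    using measurable_compose[OF measurable_tape_component assms] by (intro measurable_restrict)
  show ?thesis
  proof (rule PiM_eqI)
    fix A assume "\<And>i. i \<in> {..<N} \<Longrightarrow> A i \<in> sets (distr unif borel (g i))"
    then have A: "A i \<in> sets borel" if "i < N" for i using that by simp
    have "emeasure (distr tape (PiM {..<N} (\<lambda>_. borel)) (\<lambda>\<omega>. \<lambda>j\<in>{..<N}. g j (\<omega> j))) (Pi\<^sub>E {..<N} A)
        = emeasure tape ((\<lambda>\<omega>. \<lambda>j\<in>{..<N}. g j (\<omega> j)) -` Pi\<^sub>E {..<N} A \<inter> space tape)"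
      using A by (intro emeasure_distr[OF M] sets_PiM_I_finite) auto
    also have "(\<lambda>\<omega>. \<lambda>j\<in>{..<N}. g j (\<omega> j)) -` Pi\<^sub>E {..<N} A \<inter> space tape
        = prod_emb UNIV (\<lambda>_. unif) {..<N} (Pi\<^sub>E {..<N} (\<lambda>j. g j -` A j))"
      by (auto simp: prod_emb_def tape_eq space_PiM PiE_iff restrict_def extensional_def)
    also have "emeasure tape \<dots> = (\<Prod>j<N. emeasure unif (g j -` A j))"
      unfolding tape_eq using A measurable_sets[OF assms]
      by (intro emeasure_PiM_emb) (auto intro: prob_space_unif)
    also have "\<dots> = (\<Prod>j<N. emeasure (distr unif borel (g j)) (A j))"
      using A by (intro prod.cong refl) (simp add: emeasure_distr unif_def)
    finally show "emeasure (distr tape (PiM {..<N} (\<lambda>_. borel)) (\<lambda>\<omega>. \<lambda>j\<in>{..<N}. g j (\<omega> j))) (Pi\<^sub>E {..<N} A)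
      = (\<Prod>j<N. emeasure (distr unif borel (g j)) (A j))" .
  qed (simp_all cong: sets_PiM_cong)
qed

text \<open>A value beyond \<open>s\<close> forces \<open>u\<close> to lie within
  \<open>exp (- s) / 2\<close> of 0 or 1. Working with the quantile function avoids integrating the
  density.\<close>

lemma emeasure_lap_tail:
  assumes "0 \<le> s"
  shows "emeasure unif {u. s < \<bar>lap u\<bar>} \<le> exp (- s)"
proof -
  let ?h = "exp (- s) / 2"
  have h: "0 < ?h" "?h \<le> 1 / 2" using assms by auto
  have "{0..1} \<inter> {u. s < \<bar>lap u\<bar>} \<subseteq> {0..?h} \<union> {1 - ?h..1}"
  proof
    fix u assume "u \<in> {0..1} \<inter> {u. s < \<bar>lap u\<bar>}"
    then have u: "0 \<le> u" "u \<le> 1" "s < \<bar>lap u\<bar>" by auto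
    have aux: "v < exp (- s)" if "0 < v" "v \<le> 1" "s < \<bar>ln v\<bar>" for v :: real
    proof -
      have "ln v < - s" using that by (simp add: abs_if split: if_splits)
      then show ?thesis using that by (metis exp_less_cancel_iff exp_ln)
    qed
    show "u \<in> {0..?h} \<union> {1 - ?h..1}"
    proof (cases "2 * u \<le> 1")
      case True
      show ?thesis using u aux[of "2 * u"] True h by (cases "u = 0") (auto simp: lap_def)
    next
      case False
      show ?thesis using u aux[of "2 - 2 * u"] False h
        by (cases "u = 1") (auto simp: lap_def field_simps)
    qed
  qed
  then have "emeasure lborel ({0..1} \<inter> {u. s < \<bar>lap u\<bar>}) \<le> emeasure lborel ({0..?h} \<union> {1 - ?h..1})"
    by (rule emeasure_mono) simp
  also have "\<dots> \<le> emeasure lborel {0..?h} + emeasure lborel {1 - ?h..1}"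
    by (rule emeasure_subadditive) auto
  also have "\<dots> = exp (- s)" using h by (simp add: ennreal_plus[symmetric] del: ennreal_plus)
  finally show ?thesis by (subst emeasure_unif) auto
qed

lemma lap_tail_union_bound:
  assumes "0 \<le> s"
  shows "measure tape {\<omega> \<in> space tape. \<forall>j<N. \<bar>lap (\<omega> j)\<bar> \<le> s} \<ge> 1 - real N * exp (- s)"
proof -
  interpret prob_space tape by (rule prob_space_tape)
  have comp: "(\<lambda>\<omega>. \<omega> j) \<in> tape \<rightarrow>\<^sub>M unif" for j
    unfolding tape_eq by measurable
  have [measurable]: "(\<lambda>\<omega>. lap (\<omega> j)) \<in> borel_measurable tape" for j
    by (rule measurable_compose[OF comp]) measurable
  have one: "measure tape {\<omega> \<in> space tape. s < \<bar>lap (\<omega> j)\<bar>} \<le> exp (- s)" for j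
  proof -
    have "emeasure tape {\<omega> \<in> space tape. s < \<bar>lap (\<omega> j)\<bar>}
        = emeasure (distr tape unif (\<lambda>\<omega>. \<omega> j)) {u. s < \<bar>lap u\<bar>}"
      using comp by (subst emeasure_distr) (auto intro!: arg_cong[where f = "emeasure tape"])
    also have "distr tape unif (\<lambda>\<omega>. \<omega> j) = unif"
      unfolding tape_eq by (rule distr_PiM_component) (auto intro: prob_space_unif)
    finally have "ennreal (measure tape {\<omega> \<in> space tape. s < \<bar>lap (\<omega> j)\<bar>}) \<le> ennreal (exp (- s))"
      using emeasure_lap_tail[OF assms] by (simp add: emeasure_eq_measure)
    then show ?thesis by (subst (asm) ennreal_le_iff) auto
  qed
  have "measure tape (\<Union>j<N. {\<omega> \<in> space tape. s < \<bar>lap (\<omega> j)\<bar>})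
      \<le> (\<Sum>j<N. measure tape {\<omega> \<in> space tape. s < \<bar>lap (\<omega> j)\<bar>})"
    by (rule finite_measure_subadditive_finite) auto
  also have "\<dots> \<le> real N * exp (- s)"
    using sum_mono[of "{..<N}" "\<lambda>j. measure tape {\<omega> \<in> space tape. s < \<bar>lap (\<omega> j)\<bar>}" "\<lambda>_. exp (- s)"]
      one by simp
  finally have *: "measure tape (\<Union>j<N. {\<omega> \<in> space tape. s < \<bar>lap (\<omega> j)\<bar>}) \<le> real N * exp (- s)" .
  have "{\<omega> \<in> space tape. \<forall>j<N. \<bar>lap (\<omega> j)\<bar> \<le> s}
      = space tape - (\<Union>j<N. {\<omega> \<in> space tape. s < \<bar>lap (\<omega> j)\<bar>})"
    by (auto simp: not_le[symmetric])
  then show ?thesis using * by (simp add: prob_compl)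
qed

section \<open>Evaluating a polynomial\<close>

text \<open>The values of the monomials in the order of \<^const>\<open>exponents\<close>, by Pascal's recursion: a monomial
  either does not use the first variable or is that variable times a monomial of smaller degree. Every
  branching node has two nonempty subtrees, so a traversal visits \<open>2 * N - 1\<close> nodes even if \<open>m\<close> or
  \<open>t\<close> is not bounded by a polynomial in \<open>N\<close> (as for \<open>t = 0\<close> or \<open>m = 0\<close>).\<close>

fun monomials :: "real list \<Rightarrow> nat \<Rightarrow> real list" where
  "monomials [] t = [1]"
| "monomials (z # zs) 0 = [1]"
| "monomials (z # zs) (Suc t) = monomials zs (Suc t) @ map ((*) z) (monomials (z # zs) t)"

lemma exponents_0: "exponents m 0 = [replicate m 0]"
  by (induction m) auto

text \<open>Pascal's rule for the enumeration, order included: first the exponents starting with 0,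
  then those of degree at most \<open>t\<close> with the first entry raised by one. The order has to
  agree with the coefficient lists that \<open>B\<close> produces.\<close>

lemma exponents_Suc_Suc:
  "exponents (Suc m) (Suc t) =
    map ((#) 0) (exponents m (Suc t)) @ map (\<lambda>e. Suc (hd e) # tl e) (exponents (Suc m) t)"
proof -
  have "[0..<Suc (Suc t)] = 0 # map Suc [0..<Suc t]"
    by (simp only: upt_conv_Cons[of 0 "Suc (Suc t)"] map_Suc_upt zero_less_Suc)
  then have "exponents (Suc m) (Suc t) = map ((#) 0) (exponents m (Suc t)) @
      concat (map (\<lambda>k. map ((#) (Suc k)) (exponents m (t - k))) [0..<Suc t])"
    by (simp only: exponents.simps list.map concat.simps map_map comp_def diff_zero diff_Suc_Suc)
  then show ?thesis
    by (simp only: exponents.simps map_concat map_map comp_def list.sel)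
qed

lemma monomials_eq:
  "monomials zs t = map (\<lambda>e. \<Prod>i<length zs. zs ! i ^ (e ! i)) (exponents (length zs) t)"
proof (induction zs t rule: monomials.induct)
  case (2 z zs)
  show ?case by (simp add: exponents_0 del: exponents.simps replicate.simps)
next
  case (3 z zs t)
  have shift: "(\<Prod>i<Suc (length zs). (z # zs) ! i ^ ((k # e) ! i)) =
      z ^ k * (\<Prod>i<length zs. zs ! i ^ (e ! i))" for k e
    by (subst prod.lessThan_Suc_shift) simp
  have "map (\<lambda>e. \<Prod>i<Suc (length zs). (z # zs) ! i ^ ((Suc (hd e) # tl e) ! i)) (exponents (Suc (length zs)) t)
      = map (\<lambda>e. z * (\<Prod>i<Suc (length zs). (z # zs) ! i ^ (e ! i))) (exponents (Suc (length zs)) t)"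
  proof (rule map_cong[OF refl])
    fix e assume "e \<in> set (exponents (Suc (length zs)) t)"
    then have "e \<noteq> []" by (auto simp: set_exponents simp del: exponents.simps)
    then obtain k e' where "e = k # e'" by (cases e) auto
    then show "(\<Prod>i<Suc (length zs). (z # zs) ! i ^ ((Suc (hd e) # tl e) ! i)) =
        z * (\<Prod>i<Suc (length zs). (z # zs) ! i ^ (e ! i))"
      by (simp only: shift list.sel power_Suc mult.assoc)
  qed
  then show ?case
    unfolding monomials.simps 3 list.size add_0_right add_Suc_right
    by (simp only: exponents_Suc_Suc map_append map_map comp_def shift power_0 mult_1)
qed simp

lemma poly_val_monomials:
  assumes "length a = (length zs + t) choose t"
  shows "poly_val (length zs) t a (\<lambda>i. zs ! i) = sum_list (map2 (*) (monomials zs t) a)"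
  unfolding poly_val_def monomials_eq using assms
  by (simp add: sum_list_sum_nth length_exponents atLeast0LessThan mult.commute)

lemma length_monomials: "length (monomials zs t) = (length zs + t) choose t"
  by (simp add: monomials_eq length_exponents)

lemma poly_val_cong: "(\<And>i. i < m \<Longrightarrow> z i = z' i) \<Longrightarrow> poly_val m t a z = poly_val m t a z'"
  unfolding poly_val_def by simp

text \<open>The state is a stack of subtrees (remaining variables, degree, value of the prefix), the partial
  sum and the unread coefficients.\<close>

abbreviation "ev_vars \<equiv> First (First (First (Var 0)))"
abbreviation "ev_degree \<equiv> First (Second (First (First (Var 0))))"
abbreviation "ev_prefix \<equiv> Second (Second (First (First (Var 0))))"
abbreviation "ev_rest \<equiv> Second (First (Var 0))"
abbreviation "ev_total \<equiv> First (Second (Var 0))"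
abbreviation "ev_coeffs \<equiv> Second (Second (Var 0))"

section \<open>Traversing the monomial tree on the machine\<close>

definition ev_leaf :: prog where
  "ev_leaf = Assign 0 (Join ev_rest (Join (Plus ev_total (Times ev_prefix (First ev_coeffs))) (Second ev_coeffs)))"

definition ev_split :: prog where
  "ev_split = Assign 0 (Join (Join (Join (Second ev_vars) (Join ev_degree ev_prefix))
     (Join (Join ev_vars (Join (Minus ev_degree (Lit 1)) (Times ev_prefix (First ev_vars)))) ev_rest)) (Second (Var 0)))"

definition ev_loop :: prog where
  "ev_loop = While (IsPair (First (Var 0)))
     (Cond (IsPair ev_vars) (Cond (Leq ev_degree (Lit 0)) ev_leaf ev_split) ev_leaf)"

lemma steps_ev_leaf:
  assumes "zs = [] \<or> t = 0"
    and "steps \<omega> 0 ev_loop (VPair rest (VPair (VReal (tot + acc * r)) (enc_reals rs)), p) b a"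
  shows "steps \<omega> 0 ev_loop
    (VPair (VPair (VPair (enc_reals zs) (VPair (VReal (real t)) (VReal acc))) rest)
      (VPair (VReal tot) (enc_reals (r # rs))), p) (b + 100) a"
proof -
  have leaf: "steps \<omega> 0 ev_leaf
    (VPair (VPair (VPair (enc_reals zs) (VPair (VReal (real t)) (VReal acc))) rest)
      (VPair (VReal tot) (enc_reals (r # rs))), p) 30
    (VPair rest (VPair (VReal (tot + acc * r)) (enc_reals rs)), p)"
    unfolding ev_leaf_def by (rule steps_assign) (auto simp: enc_reals_def)
  have body: "steps \<omega> 0 (Cond (IsPair ev_vars) (Cond (Leq ev_degree (Lit 0)) ev_leaf ev_split) ev_leaf)
    (VPair (VPair (VPair (enc_reals zs) (VPair (VReal (real t)) (VReal acc))) rest)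
      (VPair (VReal tot) (enc_reals (r # rs))), p) 90
    (VPair rest (VPair (VReal (tot + acc * r)) (enc_reals rs)), p)"
  proof (cases zs)
    case Nil
    then show ?thesis using leaf
      by (intro steps_cond[where g = False and b = 30]) (auto simp: enc_reals_def)
  next
    case (Cons z zs')
    have "steps \<omega> 0 (Cond (Leq ev_degree (Lit 0)) ev_leaf ev_split)
      (VPair (VPair (VPair (enc_reals zs) (VPair (VReal (real t)) (VReal acc))) rest)
        (VPair (VReal tot) (enc_reals (r # rs))), p) 60
      (VPair rest (VPair (VReal (tot + acc * r)) (enc_reals rs)), p)"
      using leaf assms(1) Cons by (intro steps_cond[where g = True and b = 30]) auto
    then show ?thesis using Cons
      by (intro steps_cond[where g = True and b = 60]) (auto simp: enc_reals_def)
  qed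
  show ?thesis unfolding ev_loop_def
    by (rule steps_while_true[OF _ body assms(2)[unfolded ev_loop_def]]) (auto simp: enc_bool_def)
qed

lemma steps_ev_split:
  assumes "steps \<omega> 0 ev_loop
    (VPair (VPair (VPair (enc_reals zs) (VPair (VReal (real (Suc t))) (VReal acc)))
      (VPair (VPair (enc_reals (z # zs)) (VPair (VReal (real t)) (VReal (acc * z)))) rest)) r, p) b a"
  shows "steps \<omega> 0 ev_loop
    (VPair (VPair (VPair (enc_reals (z # zs)) (VPair (VReal (real (Suc t))) (VReal acc))) rest) r, p)
    (b + 100) a"
proof -
  have body: "steps \<omega> 0 (Cond (IsPair ev_vars) (Cond (Leq ev_degree (Lit 0)) ev_leaf ev_split) ev_leaf)
    (VPair (VPair (VPair (enc_reals (z # zs)) (VPair (VReal (real (Suc t))) (VReal acc))) rest) r, p) 90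
    (VPair (VPair (VPair (enc_reals zs) (VPair (VReal (real (Suc t))) (VReal acc)))
      (VPair (VPair (enc_reals (z # zs)) (VPair (VReal (real t)) (VReal (acc * z)))) rest)) r, p)"
    unfolding ev_split_def
    by (rule steps_cond[where g = True and b = 80]; simp?)
      (auto intro!: steps_cond[where g = False and b = 60] steps_assign simp: enc_reals_def)
  show ?thesis unfolding ev_loop_def
    by (rule steps_while_true[OF _ body assms[unfolded ev_loop_def]]) (auto simp: enc_bool_def)
qed

text \<open>Continuation form: the run after a subtree is a hypothesis, so the run of the second
  subtree serves as continuation of the first, and the explicit stack mirrors the recursion of
  \<open>monomials\<close>. A subtree with \<open>n\<close> leaves has \<open>2 * n - 1\<close>
  nodes, each of which costs at most 100.\<close>

lemma steps_ev_loop: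
  assumes "length rs = length (monomials zs t)"
    and "steps \<omega> 0 ev_loop (VPair rest
      (VPair (VReal (tot + acc * sum_list (map2 (*) (monomials zs t) rs))) (enc_reals rs')), p) b a"
  shows "steps \<omega> 0 ev_loop
    (VPair (VPair (VPair (enc_reals zs) (VPair (VReal (real t)) (VReal acc))) rest)
      (VPair (VReal tot) (enc_reals (rs @ rs'))), p)
    (b + 100 * (2 * real (length (monomials zs t)) - 1)) a"
  using assms
proof (induction zs t arbitrary: acc rest tot rs rs' b rule: monomials.induct)
  case (1 t)
  then obtain r where "rs = [r]" by (cases rs) auto
  then show ?case using steps_ev_leaf[of "[]" t \<omega> rest tot acc r rs' p b a] 1 by simp
next
  case (2 z zs)
  then obtain r where "rs = [r]" by (cases rs) auto
  then show ?case using steps_ev_leaf[of "z # zs" 0 \<omega> rest tot acc r rs' p b a] 2 by simp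
next
  case (3 z zs t)
  define n1 n2 where "n1 = length (monomials zs (Suc t))" and "n2 = length (monomials (z # zs) t)"
  define r1 r2 where "r1 = take n1 rs" and "r2 = drop n1 rs"
  have rs: "rs = r1 @ r2" "length r1 = n1" "length r2 = n2"
    using 3(3) by (auto simp: r1_def r2_def n1_def n2_def)
  have scale: "sum_list (map2 (*) (map ((*) z) xs) ys) = z * sum_list (map2 (*) xs ys)" for xs ys
    by (induction xs ys rule: list_induct2') (auto simp: algebra_simps)
  let ?S1 = "sum_list (map2 (*) (monomials zs (Suc t)) r1)"
  let ?S2 = "sum_list (map2 (*) (monomials (z # zs) t) r2)"
  have sum: "tot + acc * sum_list (map2 (*) (monomials (z # zs) (Suc t)) rs)
      = tot + acc * ?S1 + (acc * z) * ?S2"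
    using rs by (simp add: scale n1_def algebra_simps)
  have second: "steps \<omega> 0 ev_loop
    (VPair (VPair (VPair (enc_reals (z # zs)) (VPair (VReal (real t)) (VReal (acc * z)))) rest)
      (VPair (VReal (tot + acc * ?S1)) (enc_reals (r2 @ rs'))), p)
    (b + 100 * (2 * real n2 - 1)) a"
    unfolding n2_def using 3(4) rs unfolding sum by (intro 3(2)) (auto simp: n2_def)
  have first: "steps \<omega> 0 ev_loop
    (VPair (VPair (VPair (enc_reals zs) (VPair (VReal (real (Suc t))) (VReal acc)))
        (VPair (VPair (enc_reals (z # zs)) (VPair (VReal (real t)) (VReal (acc * z)))) rest))
      (VPair (VReal tot) (enc_reals (r1 @ (r2 @ rs')))), p)
    (b + 100 * (2 * real n2 - 1) + 100 * (2 * real n1 - 1)) a"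
    unfolding n1_def using second rs by (intro 3(1)) (auto simp: n1_def)
  show ?case
    using steps_mono[OF steps_ev_split[OF first]] rs(1) by (simp add: n1_def n2_def)
qed

abbreviation "ev_input_degree \<equiv> First (Second (Second (Second (First (Var 0)))))"
abbreviation "ev_input_args \<equiv> Second (Second (Second (Second (Var 0))))"

definition evaluator_prog :: prog where
  "evaluator_prog = Seq (Assign 0 (Join (Join (Join (First (Second ev_input_args)) (Join ev_input_degree (Lit 1))) Empty)
      (Join (Lit 0) (First ev_input_args)))) (Seq ev_loop (Assign 0 ev_total))"

lemma deterministic_evaluator_prog: "deterministic evaluator_prog"
  by (simp add: evaluator_prog_def ev_loop_def ev_leaf_def ev_split_def)

lemma runs_within_evaluator_prog:
  assumes "length y = m" "N = (m + t) choose t"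
  shows "runs_within \<omega> evaluator_prog (evaluator_input (enc_instance desc d m t T) n \<epsilon> \<delta> N r y)
    (VReal (poly_val m t (map r [0..<N]) (\<lambda>i. of_bool (y ! i)))) (200 * real N)"
proof (rule runs_within_stepsI)
  define zs :: "real list" where "zs = map of_bool y"
  define rs where "rs = map r [0..<N]"
  have len: "length zs = m" "length rs = length (monomials zs t)" "length (monomials zs t) = N"
    using assms by (auto simp: zs_def rs_def length_monomials)
  \<comment> \<open>Bits are already encoded as the reals 0 and 1, so the query string is itself the
    list of variable values.\<close>
  have bits: "enc_bits y = enc_reals zs"
    by (simp add: enc_bits_def enc_reals_def zs_def comp_def enc_bool_def[abs_def])
  have "0 < N" using assms(2) by simp
  then have N: "1 \<le> real N" by linarith
  have val: "poly_val m t rs (\<lambda>i. of_bool (y ! i)) = sum_list (map2 (*) (monomials zs t) rs)"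
    using poly_val_monomials[of rs zs t] len assms
    by (subst poly_val_cong[of m _ "\<lambda>i. zs ! i"]) (auto simp: zs_def)
  have stop: "steps \<omega> 0 ev_loop
    (VPair VNil (VPair (VReal (0 + 1 * sum_list (map2 (*) (monomials zs t) rs))) (enc_reals [])), 0) 4
    (VPair VNil (VPair (VReal (0 + 1 * sum_list (map2 (*) (monomials zs t) rs))) (enc_reals [])), 0)"
    unfolding ev_loop_def by (rule steps_while_false) (auto simp: enc_bool_def)
  show "steps \<omega> 0 evaluator_prog (evaluator_input (enc_instance desc d m t T) n \<epsilon> \<delta> N r y, 0) (200 * real N)
    (VReal (poly_val m t (map r [0..<N]) (\<lambda>i. of_bool (y ! i))), 0)"
    unfolding evaluator_prog_def
  proof (rule steps_seq[OF _ steps_seq[OF steps_ev_loop[OF len(2) stop]]])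
    show "steps \<omega> 0 (Assign 0 (Join (Join (Join (First (Second ev_input_args)) (Join ev_input_degree (Lit 1))) Empty)
        (Join (Lit 0) (First ev_input_args)))) (evaluator_input (enc_instance desc d m t T) n \<epsilon> \<delta> N r y, 0) 50
      (VPair (VPair (VPair (enc_reals zs) (VPair (VReal (real t)) (VReal 1))) VNil)
       (VPair (VReal 0) (enc_reals (rs @ []))), 0)"
      by (rule steps_assign)
        (auto simp: evaluator_input_def enc_instance_def bits enc_vec_def rs_def)
    show "steps \<omega> 0 (Assign 0 ev_total)
     (VPair VNil (VPair (VReal (0 + 1 * sum_list (map2 (*) (monomials zs t) rs))) (enc_reals [])), 0) 10
     (VReal (poly_val m t (map r [0..<N]) (\<lambda>i. of_bool (y ! i))), 0)"
      by (rule steps_assign) (auto simp: val[unfolded rs_def] rs_def)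
  qed (use N len in auto)
qed

section \<open>The sanitizer\<close>

text \<open>The value \<^const>\<open>VNil\<close> reads as a zero vector of every length, which saves initialising sums.\<close>

definition coord :: "val \<Rightarrow> nat \<Rightarrow> real" where
  "coord v j = num (left ((right ^^ j) v))"

lemma coord_enc_reals: "j < length as \<Longrightarrow> coord (enc_reals as) j = as ! j"
  unfolding coord_def enc_reals_def
  by (induction as arbitrary: j) (auto simp: less_Suc_eq_0_disj funpow_swap1)

lemma coord_VNil: "coord VNil j = 0"
proof -
  have "(right ^^ j) VNil = VNil" by (induction j) auto
  then show ?thesis by (simp add: coord_def)
qed

section \<open>Vector arithmetic on coefficient lists\<close>

definition add_loop :: "nat \<Rightarrow> prog" where
  "add_loop K = While (IsPair (First (Var K))) (Assign K
     (Join (Second (First (Var K))) (Join (Second (First (Second (Var K))))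
       (Join (Join (Plus (First (First (Second (Var K)))) (First (First (Var K))))
         (First (Second (Second (Var K))))) (Second (Second (Second (Var K))))))))"

lemma steps_add_loop:
  "\<exists>v'. steps \<omega> K (add_loop K) (VPair (enc_reals as) (VPair v (VPair VNil rest)), p)
    (44 * real (length as) + 4)
    (VPair VNil (VPair v' (VPair (enc_reals (rev (map (\<lambda>j. coord v j + as ! j) [0..<length as]))) rest)), p)"
proof -
  define st where "st i = VPair ((right ^^ i) v)
    (VPair (enc_reals (rev (map (\<lambda>j. coord v j + as ! j) [0..<i]))) rest)" for i
  have "steps \<omega> K (add_loop K) (VPair (enc_list (map VReal as)) (st 0), p)
    (real (length (map VReal as)) * (40 + 4) + 4) (VPair VNil (st (length (map VReal as))), p)"
    unfolding add_loop_def
  proof (rule steps_foreach[where st = st and pos = "\<lambda>_. p"])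
    fix i l assume "i < length (map VReal as)"
    then show "steps \<omega> K (Assign K
     (Join (Second (First (Var K))) (Join (Second (First (Second (Var K))))
       (Join (Join (Plus (First (First (Second (Var K)))) (First (First (Var K))))
         (First (Second (Second (Var K))))) (Second (Second (Second (Var K))))))))
      (VPair (VPair (map VReal as ! i) l) (st i), p) 40 (VPair l (st (Suc i)), p)"
      by (intro steps_assign) (auto simp: st_def coord_def enc_reals_def)
  qed
  then show ?thesis
    unfolding st_def by (intro exI[of _ "(right ^^ length as) v"]) (simp add: enc_reals_def mult.commute)
qed

text \<open>\<^const>\<open>add_loop\<close> leaves its result reversed; a second pass that adds zero restores the order.\<close>

definition flip :: "nat \<Rightarrow> prog" where
  "flip K = Assign K (Join (First (Second (Second (Var K))))
     (Join Empty (Join Empty (Second (Second (Second (Var K)))))))"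

lemma steps_flip_add_loop:
  "\<exists>v'. steps \<omega> K (Seq (flip K) (add_loop K))
    (VPair VNil (VPair v (VPair (enc_reals as) rest)), p) (44 * real (length as) + 20)
    (VPair VNil (VPair v' (VPair (enc_reals (rev as)) rest)), p)"
proof -
  obtain v' where v': "steps \<omega> K (add_loop K) (VPair (enc_reals as) (VPair VNil (VPair VNil rest)), p)
    (44 * real (length as) + 4)
    (VPair VNil (VPair v' (VPair (enc_reals (rev (map (\<lambda>j. coord VNil j + as ! j) [0..<length as]))) rest)), p)"
    using steps_add_loop by blast
  have eq: "map (\<lambda>j. coord VNil j + as ! j) [0..<length as] = as"
    by (simp add: coord_VNil map_nth)
  have "steps \<omega> K (flip K) (VPair VNil (VPair v (VPair (enc_reals as) rest)), p) 16
    (VPair (enc_reals as) (VPair VNil (VPair VNil rest)), p)"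
    unfolding flip_def by (rule steps_assign) auto
  from steps_seq[OF this v'[unfolded eq], of "44 * real (length as) + 20"] show ?thesis by auto
qed

text \<open>Only variable \<open>K\<close> is preserved by the call, so the remaining rows and the
  whole input ride along as the tail of the state of \<open>add_loop\<close>. The call itself
  receives just the instance and the row.\<close>

definition row_prog :: "prog \<Rightarrow> nat \<Rightarrow> prog" where
  "row_prog B K =
    Seq (call B K (Join (First (First (Second (Var K)))) (First (First (Var K))))
      (Join (Var 0) (Join (Second (Second (Var K)))
        (Join Empty (Join (Second (First (Var K))) (First (Second (Var K))))))))
    (Seq (add_loop K) (Seq (Seq (flip K) (add_loop K))
      (Assign K (Join (First (Second (Second (Second (Var K)))))
        (Join (Second (Second (Second (Second (Var K))))) (First (Second (Second (Var K)))))))))"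

lemma steps_row_prog:
  assumes "runs_within \<omega> B (VPair (left I) x) (enc_reals a) \<tau>"
    and "deterministic B" "prog_bound B \<le> K" "0 < K"
  shows "steps \<omega> K (row_prog B K) (VPair (VPair x l) (VPair I v), p)
    (2 * real K + \<tau> + 88 * real (length a) + 200)
    (VPair l (VPair I (enc_reals (map (\<lambda>j. coord v j + a ! j) [0..<length a]))), p)"
proof -
  let ?s = "map (\<lambda>j. coord v j + a ! j) [0..<length a]"
  obtain v1 where v1: "steps \<omega> K (add_loop K) (VPair (enc_reals a) (VPair v (VPair VNil (VPair l I))), p)
    (44 * real (length a) + 4)
    (VPair VNil (VPair v1 (VPair (enc_reals (rev ?s)) (VPair l I))), p)"
    using steps_add_loop by blast
  obtain v2 where v2: "steps \<omega> K (Seq (flip K) (add_loop K))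
    (VPair VNil (VPair v1 (VPair (enc_reals (rev ?s)) (VPair l I))), p)
    (44 * real (length (rev ?s)) + 20)
    (VPair VNil (VPair v2 (VPair (enc_reals (rev (rev ?s))) (VPair l I))), p)"
    using steps_flip_add_loop by blast
  show ?thesis
    unfolding row_prog_def
  proof (rule steps_seq[OF steps_call[OF assms] steps_seq[OF v1 steps_seq[OF v2 steps_assign]]])
    show "1 + real (cost (Join (First (Second (Second (Second (Var K)))))
        (Join (Second (Second (Second (Second (Var K))))) (First (Second (Second (Var K))))))) \<le> 30"
      by simp
    show "44 * real (length (rev ?s)) + 20 + 30 \<le> 44 * real (length a) + 50" by simp
    show "44 * real (length a) + 4 + (44 * real (length a) + 50) \<le> 88 * real (length a) + 54"
      by simp
    show "4 + 2 * real K + real (cost (Join (First (First (Second (Var K)))) (First (First (Var K)))))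
       + \<tau> + real (cost (Join (Var 0) (Join (Second (Second (Var K)))
        (Join Empty (Join (Second (First (Var K))) (First (Second (Var K)))))))) \<le> 2 * real K + \<tau> + 60"
      by simp
  qed auto
qed

definition lap_expr :: "expr \<Rightarrow> expr" where
  "lap_expr u = Minus (Times (Leq (Times (Lit 2) u) (Lit 1)) (Ln (Times (Lit 2) u)))
     (Times (Minus (Lit 1) (Leq (Times (Lit 2) u) (Lit 1))) (Ln (Minus (Lit 2) (Times (Lit 2) u))))"

lemma eval_lap_expr: "eval (lap_expr e) s = VReal (lap (num (eval e s)))"
  by (simp add: lap_expr_def lap_def enc_bool_def)

definition noise_loop :: "nat \<Rightarrow> prog" where
  "noise_loop K = While (IsPair (First (Var K))) (Seq (Sample 0) (Assign K
     (Join (Second (First (Var K))) (Join (First (Second (Var K)))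
       (Join (Plus (Divide (First (First (Var K))) (Second (First (Second (Var K)))))
           (Times (First (First (Second (Var K)))) (lap_expr (Var 0))))
         (Second (Second (Var K))))))))"

lemma steps_noise_loop:
  assumes "0 < K"
  shows "steps \<omega> K (noise_loop K) (VPair (enc_reals as) (VPair (VPair (VReal b) (VReal r)) VNil), 0)
    (104 * real (length as) + 4)
    (VPair VNil (VPair (VPair (VReal b) (VReal r))
      (enc_reals (rev (map (\<lambda>j. as ! j / r + b * lap (\<omega> j)) [0..<length as])))), length as)"
proof -
  define st where "st i = VPair (VPair (VReal b) (VReal r))
    (enc_reals (rev (map (\<lambda>j. as ! j / r + b * lap (\<omega> j)) [0..<i])))" for i
  have "steps \<omega> K (noise_loop K) (VPair (enc_list (map VReal as)) (st 0), 0)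
    (real (length (map VReal as)) * (100 + 4) + 4)
    (VPair VNil (st (length (map VReal as))), length (map VReal as))"
    unfolding noise_loop_def
  proof (rule steps_foreach[where st = st and pos = "\<lambda>i. i"])
    fix i l assume "i < length (map VReal as)"
    then show "steps \<omega> K (Seq (Sample 0) (Assign K
     (Join (Second (First (Var K))) (Join (First (Second (Var K)))
       (Join (Plus (Divide (First (First (Var K))) (Second (First (Second (Var K)))))
           (Times (First (First (Second (Var K)))) (lap_expr (Var 0))))
         (Second (Second (Var K))))))))
      (VPair (VPair (map VReal as ! i) l) (st i), i) 100 (VPair l (st (Suc i)), Suc i)"
      using assms
      by (intro steps_sample) (auto simp: st_def enc_reals_def eval_lap_expr, simp add: lap_expr_def)
  qed
  then show ?thesis unfolding st_def by (simp add: enc_reals_def mult.commute)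
qed

text \<open>The noise scale involves \<open>N\<close>, which is not part of the input; it is read
  off the summed coefficient vector instead of being computed from \<open>m\<close> and
  \<open>t\<close>.\<close>

definition count_loop :: "nat \<Rightarrow> prog" where
  "count_loop K = While (IsPair (First (Var K))) (Assign K
     (Join (Second (First (Var K))) (Join (Plus (First (Second (Var K))) (Lit 1))
       (Second (Second (Var K))))))"

lemma steps_count_loop:
  "steps \<omega> K (count_loop K) (VPair (enc_reals as) (VPair (VReal 0) rest), p)
    (44 * real (length as) + 4) (VPair VNil (VPair (VReal (real (length as))) rest), p)"
proof -
  define st where "st i = VPair (VReal (real i)) rest" for i
  have "steps \<omega> K (count_loop K) (VPair (enc_list (map VReal as)) (st 0), p)
    (real (length (map VReal as)) * (40 + 4) + 4) (VPair VNil (st (length (map VReal as))), p)"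
    unfolding count_loop_def
    by (rule steps_foreach[where st = st and pos = "\<lambda>_. p"], rule steps_assign)
      (auto simp: st_def)
  then show ?thesis unfolding st_def by (simp add: enc_reals_def mult.commute)
qed

section \<open>Assembling the sanitizer program\<close>

definition noise_scale :: "real \<Rightarrow> nat \<Rightarrow> nat \<Rightarrow> real \<Rightarrow> real \<Rightarrow> real" where
  "noise_scale T N n \<epsilon> \<delta> = 12 * T * sqrt (real N * ln (1 / \<delta>)) / (\<epsilon> * real n)"

definition scale_expr :: "expr \<Rightarrow> expr \<Rightarrow> expr" where
  "scale_expr c I = Divide (Times (Times (Lit 12) (First (Second (Second (Second (Second (First I)))))))
       (Sqrt (Times c (Ln (Divide (Lit 1) (First (Second (Second (Second I)))))))))
     (Times (First (Second (Second I))) (First (Second I)))"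

definition sanitizer_core :: "prog \<Rightarrow> nat \<Rightarrow> prog" where
  "sanitizer_core B K =
    Seq (Assign K (Join (First (Second (Second (Second (Second (Var K)))))) (Join (Var K) Empty)))
    (Seq (While (IsPair (First (Var K))) (row_prog B K))
    (Seq (Assign K (Join (Second (Second (Var K))) (Join (Lit 0) (Second (Var K)))))
    (Seq (count_loop K)
    (Seq (Assign K (Join (Second (Second (Second (Var K))))
      (Join (Join (scale_expr (First (Second (Var K))) (First (Second (Second (Var K)))))
        (First (Second (First (Second (Second (Var K))))))) Empty)))
    (Seq (noise_loop K)
    (Seq (Assign K (Join Empty (Join Empty (Join (Second (Second (Var K))) Empty))))
      (Seq (flip K) (add_loop K))))))))"

definition sanitizer_prog :: "prog \<Rightarrow> nat \<Rightarrow> prog" where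
  "sanitizer_prog B K =
    Seq (Assign K (Var 0)) (Seq (sanitizer_core B K) (Assign 0 (First (Second (Second (Var K))))))"

definition mean_coeff :: "(bool list \<Rightarrow> real list) \<Rightarrow> bool list list \<Rightarrow> nat \<Rightarrow> real" where
  "mean_coeff co D j = (\<Sum>i<length D. co (D ! i) ! j) / real (length D)"

lemma runs_within_sanitizer_prog:
  assumes B: "\<And>x. x \<in> set D \<Longrightarrow>
      runs_within \<omega> B (VPair (enc_instance desc d m t T) (enc_bits x)) (enc_reals (co x)) \<tau>"
    and len: "\<And>x. x \<in> set D \<Longrightarrow> length (co x) = N"
    and "deterministic B" "prog_bound B \<le> K" "0 < K"
    and n: "length D = n" "1 \<le> n"
  shows "runs_within \<omega> (sanitizer_prog B K) (sanitizer_input (enc_instance desc d m t T) n \<epsilon> \<delta> D)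
    (enc_reals (map (\<lambda>j. mean_coeff co D j + noise_scale T N n \<epsilon> \<delta> * lap (\<omega> j)) [0..<N]))
    (real n * (2 * real K + \<tau> + 88 * real N + 204) + 192 * real N + 400)"
proof -
  let ?I = "sanitizer_input (enc_instance desc d m t T) n \<epsilon> \<delta> D"
  let ?b = "noise_scale T N n \<epsilon> \<delta>"
  let ?row = "2 * real K + \<tau> + 88 * real N + 200"
  \<comment> \<open>The sum starts as \<open>VNil\<close> because \<open>N\<close> is unknown before
    \<open>B\<close> has returned a first vector. Hence the case distinction, and
    \<open>1 \<le> n\<close> is what gives the final sum length \<open>N\<close>.\<close>
  define acc where "acc i = (if i = 0 then VNil
    else enc_reals (map (\<lambda>j. \<Sum>i'<i. co (D ! i') ! j) [0..<N]))" for i :: nat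
  define S where "S = map (\<lambda>j. \<Sum>i'<n. co (D ! i') ! j) [0..<N]"
  have accn: "acc n = enc_reals S" using n(2) by (simp add: acc_def S_def)
  have lenS: "length S = N" by (simp add: S_def)
  have rows: "steps \<omega> K (While (IsPair (First (Var K))) (row_prog B K))
    (VPair (enc_list (map enc_bits D)) (VPair ?I (acc 0)), 0)
    (real (length (map enc_bits D)) * (?row + 4) + 4)
    (VPair VNil (VPair ?I (acc (length (map enc_bits D)))), 0)"
  proof (rule steps_foreach[where st = "\<lambda>i. VPair ?I (acc i)" and pos = "\<lambda>_. 0"])
    fix i l assume i: "i < length (map enc_bits D)"
    then have Di: "D ! i \<in> set D" by simp
    have "coord (acc i) j = (\<Sum>i'<i. co (D ! i') ! j)" if "j < N" for j
      using that by (cases "i = 0") (simp_all add: acc_def coord_VNil coord_enc_reals)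
    then have "map (\<lambda>j. \<Sum>i'<Suc i. co (D ! i') ! j) [0..<N] =
        map (\<lambda>j. coord (acc i) j + co (D ! i) ! j) [0..<N]"
      by (intro map_cong) auto
    then have "acc (Suc i) = enc_reals (map (\<lambda>j. coord (acc i) j + co (D ! i) ! j) [0..<length (co (D ! i))])"
      unfolding len[OF Di] by (simp only: acc_def nat.simps if_False)
    then show "steps \<omega> K (row_prog B K) (VPair (VPair (map enc_bits D ! i) l) (VPair ?I (acc i)), 0)
       ?row (VPair l (VPair ?I (acc (Suc i))), 0)"
      using steps_row_prog[of \<omega> B ?I "enc_bits (D ! i)" "co (D ! i)" \<tau> K l "acc i" 0]
        B[OF Di] len[OF Di] assms(3-5) i by (simp add: sanitizer_input_def)
  qed
  have rows': "steps \<omega> K (While (IsPair (First (Var K))) (row_prog B K))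
    (VPair (enc_list (map enc_bits D)) (VPair ?I VNil), 0)
    (real n * (?row + 4) + 4) (VPair VNil (VPair ?I (enc_reals S)), 0)"
    using rows n(1) accn by (simp add: acc_def)
  \<comment> \<open>Since \<open>B\<close> leaves the head at 0, tape cell \<open>j\<close> belongs
    to coefficient \<open>j\<close>. The list comes out reversed, and the final pass only restores
    the order.\<close>
  define R where "R = rev (map (\<lambda>j. S ! j / real n + ?b * lap (\<omega> j)) [0..<length S])"
  have lenR: "length R = N" using lenS by (simp add: R_def)
  have noise: "steps \<omega> K (noise_loop K)
    (VPair (enc_reals S) (VPair (VPair (VReal ?b) (VReal (real n))) VNil), 0)
    (104 * real (length S) + 4)
    (VPair VNil (VPair (VPair (VReal ?b) (VReal (real n))) (enc_reals R)), length S)"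
    unfolding R_def by (rule steps_noise_loop[OF assms(5)])
  obtain v' where v': "steps \<omega> K (Seq (flip K) (add_loop K))
    (VPair VNil (VPair VNil (VPair (enc_reals R) VNil)), length S) (44 * real (length R) + 20)
    (VPair VNil (VPair v' (VPair (enc_reals (rev R)) VNil)), length S)"
    using steps_flip_add_loop by blast
  have core: "steps \<omega> K (sanitizer_core B K) (?I, 0)
    (real n * (?row + 4) + 192 * real N + 300)
    (VPair VNil (VPair v' (VPair (enc_reals (rev R)) VNil)), length S)"
    unfolding sanitizer_core_def
  proof (rule steps_seq[OF _ steps_seq[OF rows' steps_seq[OF _
        steps_seq[OF steps_count_loop steps_seq[OF _ steps_seq[OF noise steps_seq[OF _ v' order_refl]
        order_refl] order_refl] order_refl] order_refl] order_refl]])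
    show "steps \<omega> K (Assign K (Join (First (Second (Second (Second (Second (Var K)))))) (Join (Var K) Empty)))
      (?I, 0) 20 (VPair (enc_list (map enc_bits D)) (VPair ?I VNil), 0)"
      by (rule steps_assign) (auto simp: sanitizer_input_def)
    show "steps \<omega> K (Assign K (Join (Second (Second (Var K))) (Join (Lit 0) (Second (Var K)))))
      (VPair VNil (VPair ?I (enc_reals S)), 0) 20
      (VPair (enc_reals S) (VPair (VReal 0) (VPair ?I (enc_reals S))), 0)"
      by (rule steps_assign) auto
    show "steps \<omega> K (Assign K (Join (Second (Second (Second (Var K))))
      (Join (Join (scale_expr (First (Second (Var K))) (First (Second (Second (Var K)))))
        (First (Second (First (Second (Second (Var K))))))) Empty)))
      (VPair VNil (VPair (VReal (real (length S))) (VPair ?I (enc_reals S))), 0) 100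
      (VPair (enc_reals S) (VPair (VPair (VReal ?b) (VReal (real n))) VNil), 0)"
      by (rule steps_assign)
        (auto simp: scale_expr_def sanitizer_input_def enc_instance_def noise_scale_def lenS)
    show "steps \<omega> K (Assign K (Join Empty (Join Empty (Join (Second (Second (Var K))) Empty))))
      (VPair VNil (VPair (VPair (VReal ?b) (VReal (real n))) (enc_reals R)), length S) 20
      (VPair VNil (VPair VNil (VPair (enc_reals R) VNil)), length S)"
      by (rule steps_assign) auto
  qed (use lenS lenR in auto)
  have out: "rev R = map (\<lambda>j. mean_coeff co D j + ?b * lap (\<omega> j)) [0..<N]"
    using lenS n(1) by (auto simp: R_def S_def mean_coeff_def)
  show ?thesis
    unfolding sanitizer_prog_def
    by (rule runs_within_wrapI[OF core]) (use out in \<open>auto simp: algebra_simps\<close>)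
qed

section \<open>Privacy and accuracy of the output distribution\<close>

definition mechanism :: "(bool list \<Rightarrow> real list) \<Rightarrow> nat \<Rightarrow> real \<Rightarrow> bool list list \<Rightarrow> (nat \<Rightarrow> real) measure"
  where "mechanism co N b D =
    distr tape (vec_space N) (\<lambda>\<omega>. \<lambda>j\<in>{..<N}. mean_coeff co D j + b * lap (\<omega> j))"

text \<open>The pushforward of the tape is what the program computes and what the accuracy argument
  uses; privacy needs the product of independent coordinates.\<close>

lemma mechanism_eq_PiM: "mechanism co N b D = PiM {..<N} (\<lambda>j. laplace (mean_coeff co D j) b)"
  unfolding mechanism_def vec_space_def laplace_def by (rule distr_tape) measurable

lemma measurable_mechanism:
  "(\<lambda>\<omega>. \<lambda>j\<in>{..<N}. mean_coeff co D j + b * lap (\<omega> j)) \<in> tape \<rightarrow>\<^sub>M vec_space N"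
  unfolding vec_space_def tape_eq by measurable

lemma mean_coeff_sensitivity:
  assumes D: "D \<in> databases n X" "D' \<in> databases n X" "adjacent D D'"
    and co: "\<And>x. x \<in> X \<Longrightarrow> \<bar>co x ! j\<bar> \<le> T"
  shows "\<bar>mean_coeff co D j - mean_coeff co D' j\<bar> \<le> 2 * T / real n"
proof -
  have len: "length D = n" "length D' = n" "set D \<subseteq> X" "set D' \<subseteq> X"
    using D by (auto simp: databases_def)
  have "card {i. i < n \<and> D ! i \<noteq> D' ! i} = 1"
    using D(3) len by (simp add: adjacent_def)
  then obtain i0 where i0: "{i. i < n \<and> D ! i \<noteq> D' ! i} = {i0}"
    by (rule card_1_singletonE)
  have i0n: "i0 < n" using i0 by blast
  have same: "D ! i = D' ! i" if "i < n" "i \<noteq> i0" for i using i0 that by blast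
  have "(\<Sum>i<n. co (D ! i) ! j) - (\<Sum>i<n. co (D' ! i) ! j) = (\<Sum>i<n. co (D ! i) ! j - co (D' ! i) ! j)"
    by (simp add: sum_subtractf)
  also have "\<dots> = (\<Sum>i\<in>{i0}. co (D ! i) ! j - co (D' ! i) ! j)"
    using same i0n by (intro sum.mono_neutral_right) auto
  finally have "\<bar>(\<Sum>i<n. co (D ! i) ! j) - (\<Sum>i<n. co (D' ! i) ! j)\<bar> \<le> \<bar>co (D ! i0) ! j\<bar> + \<bar>co (D' ! i0) ! j\<bar>"
    by simp
  also have "\<dots> \<le> T + T"
    using i0n len by (intro add_mono co) (auto simp: subset_iff)
  finally show ?thesis
    unfolding mean_coeff_def len diff_divide_distrib[symmetric] by (simp add: divide_right_mono)
qed

lemma mechanism_private: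
  assumes "1 \<le> N" "0 < \<epsilon>" "0 < \<delta>" "\<epsilon> \<le> 50 * ln (1 / \<delta>)" "1 \<le> n" "0 \<le> T"
    and co: "\<And>x j. x \<in> X \<Longrightarrow> j < N \<Longrightarrow> \<bar>co x ! j\<bar> \<le> T"
  shows "differentially_private \<epsilon> \<delta> (databases n X) (mechanism co N (noise_scale T N n \<epsilon> \<delta>))"
  unfolding differentially_private_def
proof (intro ballI impI)
  fix D D' S
  let ?b = "noise_scale T N n \<epsilon> \<delta>"
  assume D: "D \<in> databases n X" "D' \<in> databases n X" "adjacent D D'"
    and S: "S \<in> sets (mechanism co N ?b D)"
  define l where "l = ln (1 / \<delta>)"
  \<comment> \<open>\<open>\<delta> < 1\<close> is implicit in
    \<open>0 < \<epsilon> \<le> 50 * l\<close>.\<close>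
  have l: "0 < l" using assms(2,4) by (simp add: l_def)
  show "measure (mechanism co N ?b D) S \<le> exp \<epsilon> * measure (mechanism co N ?b D') S + \<delta>"
  proof (cases "T = 0")
    \<comment> \<open>The noise scale vanishes here, so there is no density to work with; but all
      coefficients are 0, and both databases have the same output law.\<close>
    case True
    then have z: "co x ! j = 0" if "x \<in> X" "j < N" for x j
      using co[OF that] by simp
    have "mean_coeff co E j = 0" if "E \<in> databases n X" "j < N" for E j
      using that by (auto simp: mean_coeff_def databases_def subset_iff intro!: sum.neutral z)
    then have "mechanism co N ?b D = mechanism co N ?b D'"
      using D(1,2) unfolding mechanism_eq_PiM by (intro PiM_cong) auto
    moreover have "1 * measure (mechanism co N ?b D') S \<le> exp \<epsilon> * measure (mechanism co N ?b D') S"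
      using assms(2) by (intro mult_right_mono) auto
    ultimately show ?thesis using assms(3) by simp
  next
    case False
    define r where "r = sqrt (real N * l)"
    \<comment> \<open>\<open>\<eta> * ?b\<close> is the sensitivity of a coefficient; any \<open>\<kappa> = s * l / \<epsilon>\<close> with \<open>s\<^sup>2 - 22 * s + 72 \<le> 0\<close> would do.\<close>
    define \<eta> \<kappa> where "\<eta> = \<epsilon> / (6 * r)" and "\<kappa> = 11 * l / \<epsilon>"
    have r: "0 < r" "r\<^sup>2 = real N * l" using l assms(1) by (simp_all add: r_def)
    have b_eq: "?b = 12 * T * r / (\<epsilon> * real n)" by (simp add: noise_scale_def l_def r_def)
    have b: "0 < ?b"
      unfolding b_eq using False assms(2,5,6) r(1) by simp
    have pos: "0 < \<eta>" "0 \<le> \<kappa>"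
      using r(1) l assms(2) by (simp_all add: \<eta>_def \<kappa>_def)
    have \<eta>b: "\<eta> * ?b = 2 * T / real n"
      unfolding b_eq \<eta>_def using r(1) assms(2) by (simp add: field_simps)
    have "measure (mechanism co N ?b D) S \<le> exp \<epsilon> * measure (mechanism co N ?b D') S
        + exp (real (card {..<N}) * (\<kappa> * (\<kappa> + 1) * \<eta>\<^sup>2 / 2) - \<kappa> * \<epsilon>)"
      unfolding mechanism_eq_PiM
    proof (rule laplace_mechanism_private[OF finite_lessThan b pos])
      show "\<bar>mean_coeff co D i - mean_coeff co D' i\<bar> \<le> \<eta> * ?b" if "i \<in> {..<N}" for i
        unfolding \<eta>b using that co by (intro mean_coeff_sensitivity[OF D]) auto
      show "S \<in> sets (PiM {..<N} (\<lambda>_. borel))"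
        using S by (simp add: mechanism_def vec_space_def)
    qed
    also have "exp (real (card {..<N}) * (\<kappa> * (\<kappa> + 1) * \<eta>\<^sup>2 / 2) - \<kappa> * \<epsilon>) \<le> exp (- l)"
    proof -
      have \<eta>2: "real N * \<eta>\<^sup>2 = \<epsilon>\<^sup>2 / (36 * l)"
        using l assms(1) by (simp add: \<eta>_def power_divide power_mult_distrib r(2))
      have "real N * (\<kappa> * (\<kappa> + 1) * \<eta>\<^sup>2 / 2) = \<kappa> * (\<kappa> + 1) / 2 * (real N * \<eta>\<^sup>2)" by simp
      also have "\<dots> = 11 * (11 * l + \<epsilon>) / 72"
        unfolding \<eta>2 \<kappa>_def using l assms(2) by (simp add: field_simps power2_eq_square)
      \<comment> \<open>\<open>\<epsilon> \<le> 50 * l\<close> bounds the left side by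
        \<open>671 * l / 72\<close>. The remaining margin of \<open>l\<close> against
        \<open>\<kappa> * \<epsilon> = 11 * l\<close> becomes
        \<open>exp (- l) = \<delta>\<close>.\<close>
      also have "\<dots> \<le> 10 * l"
        using assms(4)[folded l_def] l by (simp add: field_simps)
      finally have "real N * (\<kappa> * (\<kappa> + 1) * \<eta>\<^sup>2 / 2) \<le> 10 * l" .
      moreover have "\<kappa> * \<epsilon> = 11 * l" using assms(2) by (simp add: \<kappa>_def)
      ultimately show ?thesis by simp
    qed
    also have "exp (- l) = \<delta>" using assms(3) by (simp add: l_def ln_div)
    finally show ?thesis by simp
  qed
qed

lemma poly_val_diff_le:
  assumes "\<And>j. j < N \<Longrightarrow> \<bar>a ! j - a' ! j\<bar> \<le> e" "N = (m + t) choose t"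
  shows "\<bar>poly_val m t a (\<lambda>i. of_bool (y ! i)) - poly_val m t a' (\<lambda>i. of_bool (y ! i))\<bar> \<le> real N * e"
proof -
  let ?\<mu> = "\<lambda>j. (\<Prod>i<m. of_bool (y ! i) ^ (exponents m t ! j ! i)) :: real"
  have \<mu>: "\<bar>?\<mu> j\<bar> \<le> 1" for j
    unfolding abs_prod by (rule prod_le_1) (auto simp: power_le_one power_abs)
  have "poly_val m t a (\<lambda>i. of_bool (y ! i)) - poly_val m t a' (\<lambda>i. of_bool (y ! i))
      = (\<Sum>j<N. (a ! j - a' ! j) * ?\<mu> j)"
    by (simp add: poly_val_def assms(2) sum_subtractf left_diff_distrib)
  also have "\<bar>\<dots>\<bar> \<le> (\<Sum>j<N. \<bar>(a ! j - a' ! j) * ?\<mu> j\<bar>)" by (rule sum_abs)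
  also have "\<dots> \<le> (\<Sum>j<N. e * 1)"
    unfolding abs_mult using assms(1) \<mu> by (intro sum_mono mult_mono) (auto intro: order_trans[OF abs_ge_zero])
  finally show ?thesis by simp
qed

text \<open>Evaluation is linear in the coefficients: the mean vector evaluates to the mean of the
  values of the row polynomials, while the counting query is the mean of \<open>family_fun\<close>
  over the rows. An error of \<open>\<gamma>\<close> per row survives averaging.\<close>

lemma mean_poly_accurate:
  assumes D: "D \<in> databases n X" "1 \<le> n"
    and co: "\<And>x. x \<in> X \<Longrightarrow> \<bar>family_fun q x y - poly_val m t (co x) z\<bar> \<le> \<gamma>"
  shows "\<bar>poly_val m t (map (mean_coeff co D) [0..<(m + t) choose t]) z - counting_query (q y) D\<bar> \<le> \<gamma>"
proof -
  have len: "length D = n" "set D \<subseteq> X" using D by (auto simp: databases_def)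
  let ?\<mu> = "\<lambda>j. \<Prod>i<m. z i ^ (exponents m t ! j ! i)"
  have "poly_val m t (map (mean_coeff co D) [0..<(m + t) choose t]) z =
      (\<Sum>j<(m + t) choose t. (\<Sum>i<n. co (D ! i) ! j * ?\<mu> j) / real n)"
    by (simp add: poly_val_def mean_coeff_def len sum_distrib_right)
  also have "\<dots> = (\<Sum>i<n. poly_val m t (co (D ! i)) z) / real n"
    unfolding sum_divide_distrib[symmetric] poly_val_def by (subst sum.swap) simp
  finally have p: "poly_val m t (map (mean_coeff co D) [0..<(m + t) choose t]) z = \<dots>" .
  have c: "counting_query (q y) D = (\<Sum>i<n. family_fun q (D ! i) y) / real n"
    by (simp add: counting_query_def family_fun_def sum_list_sum_nth len atLeast0LessThan)
  have "\<bar>(\<Sum>i<n. poly_val m t (co (D ! i)) z) - (\<Sum>i<n. family_fun q (D ! i) y)\<bar>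
      \<le> (\<Sum>i<n. \<bar>poly_val m t (co (D ! i)) z - family_fun q (D ! i) y\<bar>)"
    unfolding sum_subtractf[symmetric] by (rule sum_abs)
  also have "\<dots> \<le> (\<Sum>i<n. \<gamma>)"
    using co len by (intro sum_mono) (auto simp: abs_minus_commute subset_iff)
  finally have "\<bar>(\<Sum>i<n. poly_val m t (co (D ! i)) z) - (\<Sum>i<n. family_fun q (D ! i) y)\<bar> \<le> real n * \<gamma>"
    by simp
  then show ?thesis
    unfolding p c diff_divide_distrib[symmetric] abs_divide using D(2)
    by (simp add: divide_le_eq mult.commute)
qed

text \<open>The union bound at threshold \<open>b * ln (N / \<beta>)\<close> costs
  \<open>N * exp (- ln (N / \<beta>)) = \<beta>\<close>, and summing over the monomials gives the
  factor \<open>N\<close>. One event serves all queries because it concerns the noise alone.\<close>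

lemma mechanism_accurate:
  assumes N: "N = (m + t) choose t" and n: "1 \<le> n" and Y: "Y \<subseteq> cube m" and b: "0 \<le> b" and \<beta>: "0 < \<beta>"
    and co: "\<And>x y. x \<in> X \<Longrightarrow> y \<in> Y \<Longrightarrow>
      \<bar>family_fun q x y - poly_val m t (co x) (\<lambda>i. of_bool (y ! i))\<bar> \<le> \<gamma>"
  shows "accurate (\<gamma> + real N * b * ln (real N / \<beta>)) \<beta> (databases n X) Y q (mechanism co N b)
    (\<lambda>r y. poly_val m t (map r [0..<N]) (\<lambda>i. of_bool (y ! i)))"
  unfolding accurate_def
proof
  fix D assume D: "D \<in> databases n X"
  interpret prob_space tape by (rule prob_space_tape)
  let ?ans = "\<lambda>r y. poly_val m t (map r [0..<N]) (\<lambda>i. of_bool (y ! i)) :: real"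
  let ?f = "\<lambda>\<omega>. \<lambda>j\<in>{..<N}. mean_coeff co D j + b * lap (\<omega> j)"
  define s where "s = ln (real N / \<beta>)"
  define G where "G = {r \<in> space (vec_space N). \<forall>y\<in>Y. \<bar>?ans r y - counting_query (q y) D\<bar> \<le> \<gamma> + real N * b * s}"
  have "0 < N" using N by simp
  then have N1: "1 \<le> real N" by linarith
  have G: "measure (mechanism co N b D) G \<ge> 1 - \<beta>"
  \<comment> \<open>For \<open>\<beta> \<ge> 1\<close> the claim is void, and \<open>s\<close> may
    be negative.\<close>
  proof (cases "\<beta> < 1")
    case True
    have s: "0 \<le> s" using True \<beta> N1 by (simp add: s_def)
    have Ns: "real N * exp (- s) = \<beta>"
      using N1 \<beta> by (simp add: s_def exp_minus)
    \<comment> \<open>Finitely many queries make \<open>G\<close> measurable, as needed for its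
      probability under the pushforward.\<close>
    have "finite (cube m)" unfolding cube_def using finite_lists_length_eq[of "UNIV :: bool set" m] by simp
    then have Yc: "countable Y" using Y by (meson countable_finite finite_subset)
    have ans: "(\<lambda>r. ?ans r y) \<in> borel_measurable (vec_space N)" for y
      unfolding poly_val_def N[symmetric] vec_space_def by simp
    have Gm: "G \<in> sets (vec_space N)"
      unfolding G_def using ans Yc by measurable
    have good: "?f \<omega> \<in> G" if \<omega>: "\<forall>j<N. \<bar>lap (\<omega> j)\<bar> \<le> s" for \<omega>
      unfolding G_def
    proof (intro CollectI conjI ballI)
      show "?f \<omega> \<in> space (vec_space N)" by (simp add: vec_space_def space_PiM)
      fix y assume y: "y \<in> Y"
      have "\<bar>?ans (?f \<omega>) y - ?ans (mean_coeff co D) y\<bar> \<le> real N * (b * s)"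
        using \<omega> b N by (intro poly_val_diff_le) (auto simp: abs_mult intro!: mult_left_mono)
      moreover have "\<bar>?ans (mean_coeff co D) y - counting_query (q y) D\<bar> \<le> \<gamma>"
        unfolding N using D n y co by (intro mean_poly_accurate[where X = X]) auto
      ultimately show "\<bar>?ans (?f \<omega>) y - counting_query (q y) D\<bar> \<le> \<gamma> + real N * b * s"
        by (simp add: mult.assoc)
    qed
    have "1 - \<beta> \<le> measure tape {\<omega> \<in> space tape. \<forall>j<N. \<bar>lap (\<omega> j)\<bar> \<le> s}"
      using lap_tail_union_bound[OF s, of N] Ns by simp
    also have "\<dots> \<le> measure tape (?f -` G \<inter> space tape)"
      using good measurable_sets[OF measurable_mechanism Gm] by (intro finite_measure_mono) auto
    also have "\<dots> = measure (mechanism co N b D) G"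
      unfolding mechanism_def using Gm by (intro measure_distr[symmetric] measurable_mechanism)
    finally show ?thesis .
  qed (use measure_nonneg[of "mechanism co N b D" G] in linarith)
  have "space (mechanism co N b D) = space (vec_space N)" by (simp add: mechanism_def)
  then show "1 - \<beta> \<le> measure (mechanism co N b D) {r \<in> space (mechanism co N b D).
      \<forall>y\<in>Y. \<bar>?ans r y - counting_query (q y) D\<bar> \<le> \<gamma> + real N * b * ln (real N / \<beta>)}"
    using G unfolding G_def s_def by simp
qed

section \<open>Running time and conclusion\<close>

lemma sanitizer_time_le:
  assumes X: "1 + real n + real N \<le> X" "1 + real d + real N + L \<le> X" "0 \<le> L"
  shows "real n * (2 * real K + real c * (1 + (real d + (real N + L))) ^ k + 88 * real N + 204)
    + 192 * real N + 400 \<le> real (2 * K + c + 900) * X ^ (k + 2)"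
proof -
  have X1: "1 \<le> X" "real n \<le> X" "real N \<le> X" using X by simp_all
  have p: "1 \<le> X ^ j" for j using X1(1) by (rule one_le_power)
  have pk: "X ^ j \<le> X ^ (k + 1)" if "j \<le> k + 1" for j
    using that X1(1) by (rule power_increasing)
  have "(1 + (real d + (real N + L))) ^ k \<le> X ^ k"
    using X by (intro power_mono) auto
  then have "real c * (1 + (real d + (real N + L))) ^ k \<le> real c * X ^ (k + 1)"
    using pk[of k] by (intro mult_left_mono) auto
  moreover have "real N \<le> X ^ (k + 1)" using pk[of 1] X1(3) by simp
  moreover have "2 * real K * 1 \<le> 2 * real K * X ^ (k + 1)"
    using p[of "k + 1"] by (intro mult_left_mono) auto
  ultimately have "2 * real K + real c * (1 + (real d + (real N + L))) ^ k + 88 * real N + 204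
      \<le> (2 * real K + real c + 292) * X ^ (k + 1)"
    using p[of "k + 1"] by (simp add: distrib_right)
  then have "real n * (2 * real K + real c * (1 + (real d + (real N + L))) ^ k + 88 * real N + 204)
      \<le> X * ((2 * real K + real c + 292) * X ^ (k + 1))"
    using X1 X(3) by (intro mult_mono) auto
  moreover have "X \<le> X ^ (k + 2)"
    using power_increasing[of 1 "k + 2" X] X1(1) by simp
  then have "real N \<le> X ^ (k + 2)" using X1(3) by (rule order_trans[rotated])
  moreover have "X * ((2 * real K + real c + 292) * X ^ (k + 1)) = (2 * real K + real c + 292) * X ^ (k + 2)"
    by simp
  \<comment> \<open>One power beyond \<open>k\<close> absorbs the terms linear in \<open>N\<close>,
    the other the factor \<open>n\<close>. The constant 900 splits into
    \<open>292 = 88 + 204\<close> and \<open>608 \<ge> 192 + 400\<close>.\<close>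
  moreover have "real (2 * K + c + 900) * X ^ (k + 2) =
      (2 * real K + real c + 292) * X ^ (k + 2) + 608 * X ^ (k + 2)"
    by (simp add: distrib_right[symmetric])
  ultimately show ?thesis using p[of "k + 2"] by linarith
qed

theorem theorem5:
  fixes B :: prog and c k :: nat
  assumes "deterministic B"
  shows "\<exists>(A :: prog) (E :: prog) (c' :: nat) (k' :: nat). deterministic E \<and>
    (\<forall>(desc :: bool list) (d :: nat) (m :: nat) (t :: nat) (T :: real) (\<gamma> :: real)
      (Y :: bool list set) (q :: bool list \<Rightarrow> bool list \<Rightarrow> bool) (N :: nat).
      Y \<subseteq> cube m \<longrightarrow> N = (m + t) choose t \<longrightarrow>
      efficiently_uniformly_approximates B c k desc d m t T \<gamma> Y q \<longrightarrow>
      (\<forall>(n :: nat) (\<epsilon> :: real) (\<delta> :: real).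
        1 \<le> n \<longrightarrow> 0 < \<epsilon> \<longrightarrow> 0 < \<delta> \<longrightarrow> \<epsilon> \<le> 50 * ln (1 / \<delta>) \<longrightarrow>
        (\<exists>(M :: bool list list \<Rightarrow> (nat \<Rightarrow> real) measure) (ans :: (nat \<Rightarrow> real) \<Rightarrow> bool list \<Rightarrow> real).
          let DB = databases n (cube d);
              inst = enc_instance desc d m t T;
              time = poly_bound c' k'
                [real n, real d, real N, \<bar>ln T\<bar>, \<bar>ln (1 / \<epsilon>)\<bar>, \<bar>ln (1 / \<delta>)\<bar>]
          in
            differentially_private \<epsilon> \<delta> DB M \<and>
            (\<forall>D\<in>DB. samples_within A (sanitizer_input inst n \<epsilon> \<delta> D) N (M D) time) \<and>
            (\<forall>r \<in> space (vec_space N). \<forall>y\<in>Y. \<forall>\<omega>.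
               runs_within \<omega> E (evaluator_input inst n \<epsilon> \<delta> N r y) (VReal (ans r y)) time) \<and>
            (\<forall>\<beta>>0. accurate
               (\<gamma> + 12 * T * real N * sqrt (real N * ln (1 / \<delta>)) * ln (real N / \<beta>) / (\<epsilon> * real n))
               \<beta> DB Y q M ans))))"
proof -
  \<comment> \<open>\<open>K\<close> lies above every variable of \<open>B\<close>. The programs and
    constants depend only on \<open>B\<close>, \<open>c\<close> and \<open>k\<close>, and are fixed
    before the instance.\<close>
  define K where "K = Suc (prog_bound B)"
  define c' where "c' = 2 * K + c + 900"
  show ?thesis
  proof (rule exI[of _ "sanitizer_prog B K"], rule exI[of _ evaluator_prog], rule exI[of _ c'],
      rule exI[of _ "k + 2"], intro conjI allI impI)
    show "deterministic evaluator_prog" by (rule deterministic_evaluator_prog)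
    fix desc d m t and T \<gamma> :: real and Y q N n and \<epsilon> \<delta> :: real
    assume Y: "Y \<subseteq> cube m" and N: "N = (m + t) choose t"
      and eff: "efficiently_uniformly_approximates B c k desc d m t T \<gamma> Y q"
      and n: "1 \<le> (n :: nat)" and \<epsilon>: "0 < \<epsilon>" and \<delta>: "0 < \<delta>" "\<epsilon> \<le> 50 * ln (1 / \<delta>)"
    let ?\<tau> = "poly_bound c k [real d, real N, \<bar>ln T\<bar>]"
    let ?inst = "enc_instance desc d m t T"
    let ?time = "poly_bound c' (k + 2)
      [real n, real d, real N, \<bar>ln T\<bar>, \<bar>ln (1 / \<epsilon>)\<bar>, \<bar>ln (1 / \<delta>)\<bar>]"
    let ?b = "noise_scale T N n \<epsilon> \<delta>"
    let ?ans = "\<lambda>r y. poly_val m t (map r [0..<N]) (\<lambda>i. of_bool (y ! i)) :: real"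
    from eff have "\<forall>x\<in>cube d. \<exists>a. a \<in> approximants m t T \<gamma> Y (family_fun q x) \<and>
      (\<forall>\<omega>. runs_within \<omega> B (VPair ?inst (enc_bits x)) (enc_reals a) ?\<tau>)"
      unfolding efficiently_uniformly_approximates_def N by blast
    \<comment> \<open>The hypothesis quantifies the coefficient vector before the tape, so one
      function of the row serves all tapes.\<close>
    then obtain co where co: "\<And>x. x \<in> cube d \<Longrightarrow> co x \<in> approximants m t T \<gamma> Y (family_fun q x)"
        "\<And>x \<omega>. x \<in> cube d \<Longrightarrow> runs_within \<omega> B (VPair ?inst (enc_bits x)) (enc_reals (co x)) ?\<tau>"
      by metis
    have len: "length (co x) = N" if "x \<in> cube d" for x
      using co(1)[OF that] by (simp add: approximants_def bounded_polys_def N)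
    have bd: "\<bar>co x ! j\<bar> \<le> T" if "x \<in> cube d" "j < N" for x j
      using co(1)[OF that(1)] len[OF that(1)] that(2)
      by (simp add: approximants_def bounded_polys_def)
    have approx: "\<bar>family_fun q x y - poly_val m t (co x) (\<lambda>i. of_bool (y ! i))\<bar> \<le> \<gamma>"
      if "x \<in> cube d" "y \<in> Y" for x y
      using co(1)[OF that(1)] that(2) by (simp add: approximants_def)
    have "0 < N" using N by simp
    then have N1: "1 \<le> N" by linarith
    \<comment> \<open>A row exists even for \<open>d = 0\<close>, and its vector has at least one
      coefficient, whose bound shows \<open>T \<ge> 0\<close>.\<close>
    have "replicate d True \<in> cube d" by (simp add: cube_def)
    from bd[OF this, of 0] have T: "0 \<le> T" using N1 by auto
    have "0 \<le> ln (1 / \<delta>)" using \<epsilon> \<delta> by linarith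
    then have b: "0 \<le> ?b" using T \<epsilon> by (simp add: noise_scale_def)
    let ?X = "1 + (real n + (real d + (real N + (\<bar>ln T\<bar> + (\<bar>ln (1 / \<epsilon>)\<bar> + \<bar>ln (1 / \<delta>)\<bar>)))))"
    have time: "real n * (2 * real K + ?\<tau> + 88 * real N + 204) + 192 * real N + 400 \<le> ?time"
      using sanitizer_time_le[of n N ?X d "\<bar>ln T\<bar>" K c k]
      by (simp add: poly_bound_def c'_def)
    have \<tau>0: "0 \<le> ?\<tau>" by (simp add: poly_bound_def)
    have timeE: "200 * real N \<le> ?time"
    proof -
      \<comment> \<open>The bound for the sanitizer already contains
        \<open>88 * N + 192 * N\<close>, more than the evaluator spends.\<close>
      have "1 * (88 * real N + 204) \<le> real n * (2 * real K + ?\<tau> + 88 * real N + 204)"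
        using n \<tau>0 by (intro mult_mono) auto
      then show ?thesis using time of_nat_0_le_iff[of N, where 'a = real] by argo
    qed
    have priv: "differentially_private \<epsilon> \<delta> (databases n (cube d)) (mechanism co N ?b)"
      using N1 \<epsilon> \<delta> n T bd by (rule mechanism_private)
    have samp: "samples_within (sanitizer_prog B K) (sanitizer_input ?inst n \<epsilon> \<delta> D) N
        (mechanism co N ?b D) ?time" if D: "D \<in> databases n (cube d)" for D
      unfolding samples_within_def
    proof (intro bexI[OF _ measurable_mechanism] conjI ballI)
      fix \<omega>
      have "runs_within \<omega> (sanitizer_prog B K) (sanitizer_input ?inst n \<epsilon> \<delta> D)
        (enc_reals (map (\<lambda>j. mean_coeff co D j + ?b * lap (\<omega> j)) [0..<N]))
        (real n * (2 * real K + ?\<tau> + 88 * real N + 204) + 192 * real N + 400)"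
        using D n assms
        by (intro runs_within_sanitizer_prog co(2) len) (auto simp: databases_def K_def)
      then have "runs_within \<omega> (sanitizer_prog B K) (sanitizer_input ?inst n \<epsilon> \<delta> D)
        (enc_reals (map (\<lambda>j. mean_coeff co D j + ?b * lap (\<omega> j)) [0..<N])) ?time"
        using time unfolding runs_within_def by (meson order_trans)
      moreover have "map (\<lambda>j. mean_coeff co D j + ?b * lap (\<omega> j)) [0..<N] =
          map (\<lambda>j\<in>{..<N}. mean_coeff co D j + ?b * lap (\<omega> j)) [0..<N]"
        by simp
      ultimately show "runs_within \<omega> (sanitizer_prog B K) (sanitizer_input ?inst n \<epsilon> \<delta> D)
         (enc_vec N (\<lambda>j\<in>{..<N}. mean_coeff co D j + ?b * lap (\<omega> j))) ?time"
        unfolding enc_vec_def by simp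
    qed (simp add: mechanism_def)
    have evalr: "runs_within \<omega> evaluator_prog (evaluator_input ?inst n \<epsilon> \<delta> N r y) (VReal (?ans r y)) ?time"
      if "y \<in> Y" for \<omega> r y
    proof -
      have "length y = m" using that Y by (auto simp: cube_def)
      from runs_within_evaluator_prog[OF this N] timeE show ?thesis
        unfolding runs_within_def by (meson order_trans)
    qed
    have acc: "accurate
        (\<gamma> + 12 * T * real N * sqrt (real N * ln (1 / \<delta>)) * ln (real N / \<beta>) / (\<epsilon> * real n))
        \<beta> (databases n (cube d)) Y q (mechanism co N ?b) ?ans" if "0 < \<beta>" for \<beta>
    proof -
      have "real N * ?b * ln (real N / \<beta>) =
          12 * T * real N * sqrt (real N * ln (1 / \<delta>)) * ln (real N / \<beta>) / (\<epsilon> * real n)"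
        by (simp add: noise_scale_def)
      then show ?thesis
        using mechanism_accurate[where X = "cube d", OF N n Y b that approx] by simp
    qed
    show "\<exists>M ans.
      let DB = databases n (cube d);
          inst = enc_instance desc d m t T;
          time = poly_bound c' (k + 2)
            [real n, real d, real N, \<bar>ln T\<bar>, \<bar>ln (1 / \<epsilon>)\<bar>, \<bar>ln (1 / \<delta>)\<bar>]
      in
        differentially_private \<epsilon> \<delta> DB M \<and>
        (\<forall>D\<in>DB. samples_within (sanitizer_prog B K) (sanitizer_input inst n \<epsilon> \<delta> D) N (M D) time) \<and>
        (\<forall>r \<in> space (vec_space N). \<forall>y\<in>Y. \<forall>\<omega>.
           runs_within \<omega> evaluator_prog (evaluator_input inst n \<epsilon> \<delta> N r y) (VReal (ans r y)) time) \<and>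
        (\<forall>\<beta>>0. accurate
           (\<gamma> + 12 * T * real N * sqrt (real N * ln (1 / \<delta>)) * ln (real N / \<beta>) / (\<epsilon> * real n))
           \<beta> DB Y q M ans)"
      unfolding Let_def using priv samp evalr acc
      by (intro exI[of _ "mechanism co N ?b"] exI[of _ ?ans]) blast
  qed
qed

end
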